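(* Let $\Omega$ be any open subset of $\mathbb{R}^{N+1}$, and suppose that $c=0$. Let $z_0=(x_0,t_0)\in\Omega$, let $f$ be continuous on $\Omega$ and let $u$ be a classical solution to $\mathscr{L}u=f$ in $\Omega$. If $u(z_0)=\max_\Omega u$ and $f\ge0$ in $\Omega$, then $$u(z)=u(z_0)\quad\text{and}\quad f(z)=0\qquad\text{for every } z\in\overline{\mathscr{A}_{z_0}(\Omega)},$$ where the closure is taken in $\Omega$. The analogous result holds if $u(z_0)=\min_\Omega u$ and $f\le0$ in $\Omega$.
   Context: Operator. Points of $\mathbb{R}^{N+1}$ are $z=(x,t)$, $x\in\mathbb{R}^N$, $t\in\mathbb{R}$; $\mathrm{div}$, $\nabla_x$, $\langle\cdot,\cdot\rangle$ are the divergence, gradient and inner product in $\mathbb{R}^N$. The operator is $$\mathscr{L}u(z)=\mathrm{div}\big(A(z)\nabla_xu(z)\big)+\langle b(z),\nabla_xu(z)\rangle+c(z)u(z)-\frac{\partial u}{\partial t}(z),$$ with $A=(a_{ij})_{i,j=1,\dots,N}$ symmetric and $b=(b_1,\dots,b_N)$. Standing assumptions: there are $M>0$, $\alpha\in\,]0,1]$ such that each function $g$ among $c,\ a_{ij},\ \partial a_{ij}/\partial x_i,\ b_i,\ \partial b_i/\partial x_i$ $(i,j=1,\dots,N)$ satisfies $|g(x,t)-g(y,s)|\le M(|x-y|^\alpha+|t-s|^{\alpha/2})$ for all $(x,t),(y,s)\in\mathbb{R}^{N+1}$; the coefficients are bounded; and there are $0<\lambda<\Lambda$ with $\lambda|\xi|^2\le\langle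 A(z)\xi,\xi\rangle\le\Lambda|\xi|^2$, $|\partial a_{ij}/\partial x_i(z)|\le\Lambda$, $|b_i(z)|\le\Lambda$, $|c(z)|\le\Lambda$ for all $\xi\in\mathbb{R}^N$, $z\in\mathbb{R}^{N+1}$, $i,j$. Classical solution: for $f$ continuous on $\Omega$, $u$ is a classical solution of $\mathscr{L}u=f$ in $\Omega$ if $u,\ \partial_{x_j}u,\ \partial^2_{x_ix_j}u,\ \partial_tu$ are continuous in $\Omega$ and the equation holds at every point of $\Omega$. Attainable set. A curve $\gamma:[0,T]\to\mathbb{R}^{N+1}$ is $\mathscr{L}$-admissible if it is absolutely continuous and $\dot\gamma(s)=(\dot x_1(s),\dots,\dot x_N(s),-1)$ for almost every $s\in[0,T]$, with $\dot x_1,\dots,\dot x_N\in L^2([0,T])$. For $\Omega$ open and $z_0\in\Omega$, $\mathscr{A}_{z_0}(\Omega)$ is the set of all $z\in\Omega$ for which there exists an $\mathscr{L}$-admissible curve $\gamma:[0,T]\to\Omega$ with $\gamma(0)=z_0$ and $\gamma(T)=z$. *)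

theory Defs
  imports "HOL-Analysis.Analysis"
begin

text \<open>Points of the space-time are pairs \<open>(x, t)\<close>; the space dimension is \<open>CARD('n)\<close>.\<close>

type_synonym 'n spacetime = "(real ^ 'n) \<times> real"

definition dir_differentiable :: "'a::real_normed_vector \<Rightarrow> ('a \<Rightarrow> real) \<Rightarrow> 'a \<Rightarrow> bool" where
  "dir_differentiable e g z \<longleftrightarrow> (\<lambda>h::real. g (z + h *\<^sub>R e)) differentiable (at 0)"

text \<open>Arbitrary value at points where \<^const>\<open>dir_differentiable\<close> fails.\<close>

definition dir_deriv :: "'a::real_normed_vector \<Rightarrow> ('a \<Rightarrow> real) \<Rightarrow> 'a \<Rightarrow> real" where
  "dir_deriv e g z = deriv (\<lambda>h::real. g (z + h *\<^sub>R e)) 0"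

abbreviation dx_exists :: "'n::finite \<Rightarrow> ('n spacetime \<Rightarrow> real) \<Rightarrow> 'n spacetime \<Rightarrow> bool" where
  "dx_exists i \<equiv> dir_differentiable (axis i 1, 0)"

abbreviation dx :: "'n::finite \<Rightarrow> ('n spacetime \<Rightarrow> real) \<Rightarrow> 'n spacetime \<Rightarrow> real" where
  "dx i \<equiv> dir_deriv (axis i 1, 0)"

abbreviation dt_exists :: "('n::finite spacetime \<Rightarrow> real) \<Rightarrow> 'n spacetime \<Rightarrow> bool" where
  "dt_exists \<equiv> dir_differentiable (0, 1)"

abbreviation dt :: "('n::finite spacetime \<Rightarrow> real) \<Rightarrow> 'n spacetime \<Rightarrow> real" where
  "dt \<equiv> dir_deriv (0, 1)"

definition grad_x :: "('n::finite spacetime \<Rightarrow> real) \<Rightarrow> 'n spacetime \<Rightarrow> real ^ 'n" where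
  "grad_x u z = (\<chi> i. dx i u z)"

definition div_x :: "('n::finite spacetime \<Rightarrow> real ^ 'n) \<Rightarrow> 'n spacetime \<Rightarrow> real" where
  "div_x F z = (\<Sum>i\<in>UNIV. dx i (\<lambda>w. F w $ i) z)"

definition parabolic_op ::
  "('n::finite spacetime \<Rightarrow> real ^ 'n ^ 'n) \<Rightarrow> ('n spacetime \<Rightarrow> real ^ 'n) \<Rightarrow> ('n spacetime \<Rightarrow> real)
    \<Rightarrow> ('n spacetime \<Rightarrow> real) \<Rightarrow> 'n spacetime \<Rightarrow> real" where
  "parabolic_op A b c u z =
     div_x (\<lambda>w. A w *v grad_x u w) z + b z \<bullet> grad_x u z + c z * u z - dt u z"

definition parabolic_holder :: "real \<Rightarrow> real \<Rightarrow> ('n::finite spacetime \<Rightarrow> real) \<Rightarrow> bool" where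
  "parabolic_holder M \<alpha> g \<longleftrightarrow>
     (\<forall>x t y s. \<bar>g (x, t) - g (y, s)\<bar> \<le> M * (norm (x - y) powr \<alpha> + \<bar>t - s\<bar> powr (\<alpha> / 2)))"

definition standing_assumptions ::
  "('n::finite spacetime \<Rightarrow> real ^ 'n ^ 'n) \<Rightarrow> ('n spacetime \<Rightarrow> real ^ 'n) \<Rightarrow> ('n spacetime \<Rightarrow> real)
    \<Rightarrow> real \<Rightarrow> real \<Rightarrow> real \<Rightarrow> real \<Rightarrow> bool" where
  "standing_assumptions A b c M \<alpha> l L \<longleftrightarrow>
     0 < M \<and> 0 < \<alpha> \<and> \<alpha> \<le> 1 \<and> 0 < l \<and> l < L \<and>
     (\<forall>z. transpose (A z) = A z) \<and>
     (\<forall>i j z. dx_exists i (\<lambda>w. A w $ i $ j) z) \<and>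
     (\<forall>i z. dx_exists i (\<lambda>w. b w $ i) z) \<and>
     parabolic_holder M \<alpha> c \<and>
     (\<forall>i j. parabolic_holder M \<alpha> (\<lambda>w. A w $ i $ j)) \<and>
     (\<forall>i j. parabolic_holder M \<alpha> (dx i (\<lambda>w. A w $ i $ j))) \<and>
     (\<forall>i. parabolic_holder M \<alpha> (\<lambda>w. b w $ i)) \<and>
     (\<forall>i. parabolic_holder M \<alpha> (dx i (\<lambda>w. b w $ i))) \<and>
     bounded (range A) \<and> bounded (range b) \<and> bounded (range c) \<and>
     (\<forall>z \<xi>. l * (norm \<xi>)\<^sup>2 \<le> (A z *v \<xi>) \<bullet> \<xi> \<and> (A z *v \<xi>) \<bullet> \<xi> \<le> L * (norm \<xi>)\<^sup>2) \<and>
     (\<forall>i j z. \<bar>dx i (\<lambda>w. A w $ i $ j) z\<bar> \<le> L) \<and>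
     (\<forall>i z. \<bar>b z $ i\<bar> \<le> L) \<and>
     (\<forall>z. \<bar>c z\<bar> \<le> L)"

definition classical_solution ::
  "('n::finite spacetime \<Rightarrow> real ^ 'n ^ 'n) \<Rightarrow> ('n spacetime \<Rightarrow> real ^ 'n) \<Rightarrow> ('n spacetime \<Rightarrow> real)
    \<Rightarrow> ('n spacetime \<Rightarrow> real) \<Rightarrow> 'n spacetime set \<Rightarrow> ('n spacetime \<Rightarrow> real) \<Rightarrow> bool" where
  "classical_solution A b c f \<Omega> u \<longleftrightarrow>
     (\<forall>z\<in>\<Omega>. dt_exists u z \<and> (\<forall>j. dx_exists j u z) \<and> (\<forall>i j. dx_exists i (dx j u) z)) \<and>
     continuous_on \<Omega> u \<and>
     (\<forall>j. continuous_on \<Omega> (dx j u)) \<and>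
     (\<forall>i j. continuous_on \<Omega> (dx i (dx j u))) \<and>
     continuous_on \<Omega> (dt u) \<and>
     (\<forall>z\<in>\<Omega>. parabolic_op A b c u z = f z)"

text \<open>The usual \<open>\<epsilon>\<close>-\<open>\<delta>\<close> definition over finite families of non-overlapping subintervals
  \<open>k = [Inf k, Sup k]\<close> of \<open>[a, b]\<close>; the family need not cover \<open>[a, b]\<close>.\<close>

definition abs_continuous_on :: "real \<Rightarrow> real \<Rightarrow> (real \<Rightarrow> 'a::real_normed_vector) \<Rightarrow> bool" where
  "abs_continuous_on a b g \<longleftrightarrow>
     (\<forall>\<epsilon>>0. \<exists>\<delta>>0. \<forall>d S. d division_of S \<and> S \<subseteq> {a..b} \<and> (\<Sum>k\<in>d. Sup k - Inf k) < \<delta>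
        \<longrightarrow> (\<Sum>k\<in>d. norm (g (Sup k) - g (Inf k))) < \<epsilon>)"

definition square_integrable_on :: "real set \<Rightarrow> (real \<Rightarrow> real) \<Rightarrow> bool" where
  "square_integrable_on S g \<longleftrightarrow>
     set_borel_measurable lebesgue S g \<and> set_integrable lebesgue S (\<lambda>s. (g s)\<^sup>2)"

definition admissible_curve :: "real \<Rightarrow> (real \<Rightarrow> 'n::finite spacetime) \<Rightarrow> bool" where
  "admissible_curve T \<gamma> \<longleftrightarrow>
     abs_continuous_on 0 T \<gamma> \<and>
     (\<exists>v :: real \<Rightarrow> real ^ 'n.
        (AE s in lebesgue. s \<in> {0..T} \<longrightarrow>
           (\<gamma> has_vector_derivative (v s, -1)) (at s within {0..T})) \<and>
        (\<forall>j. square_integrable_on {0..T} (\<lambda>s. v s $ j)))"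

text \<open>The degenerate case \<open>T = 0\<close> is allowed, so the starting point itself is attainable.\<close>

definition attainable_set :: "'n::finite spacetime \<Rightarrow> 'n spacetime set \<Rightarrow> 'n spacetime set" where
  "attainable_set z0 \<Omega> =
     {z\<in>\<Omega>. \<exists>T\<ge>0. \<exists>\<gamma>. admissible_curve T \<gamma> \<and> \<gamma> ` {0..T} \<subseteq> \<Omega> \<and> \<gamma> 0 = z0 \<and> \<gamma> T = z}"

end

theory Submission
  imports Defs
begin

text \<open>Expanding the divergence turns the equation into one in nondivergence form with a bounded drift.
  The heart of the proof is that the set where \<open>u\<close> attains its maximum \<open>m\<close> contains, together with a
  point, every segment in \<open>\<Omega>\<close> that starts there and goes strictly back in time
  (\<open>max_propagates_along_segment\<close>). If \<open>u\<close> were less than \<open>m\<close> at the early end, the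
  deficit would spread to the late end: the function
  \<open>exp (- k t) (r\<^sup>2 - |x - X t|\<^sup>2)\<^sup>2\<close> on a thin tube around the segment \<open>t \<mapsto> X t\<close>
  is, for large \<open>k\<close>, a strict subsolution that vanishes on the sides of the tube, and a small
  multiple of it lies below \<open>m - u\<close> on the bottom. At a maximum of \<open>u\<close> plus that multiple the
  elementary derivative tests contradict the equation. One slanted barrier thus replaces the
  usual two steps, propagation in space at fixed time and then downwards in time.\<close>

text \<open>An admissible curve has time component \<open>t\<^sub>0 - s\<close>, because an absolutely continuous function
  with derivative zero almost everywhere is constant
  (\<open>abs_continuous_on_zero_derivative_AE_imp_const\<close>). Hence it can be approximated in \<open>\<Omega>\<close> by polygons
  whose sides go strictly back in time, and \<open>u = m\<close> on the whole attainable set. At a point where \<open>u\<close>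
  is maximal its gradient and time derivative vanish and its second order part is nonpositive
  (\<open>trace_mult_nonpos\<close>), so \<open>f \<le> 0\<close> there, and \<open>f \<ge> 0\<close> by hypothesis. Both
  equalities pass to the closure by continuity. The statement for minima follows by applying
  this to \<open>- u\<close> and \<open>- f\<close>.\<close>

section \<open>Derivatives along lines and the second derivative test\<close>

lemma second_derivative_nonpos_at_local_max:
  fixes F F' :: "real \<Rightarrow> real"
  assumes F: "\<forall>\<^sub>F h in nhds 0. (F has_field_derivative F' h) (at h)"
    and F': "(F' has_field_derivative D) (at 0)"
    and mx: "\<forall>\<^sub>F h in nhds 0. F h \<le> F 0"
  shows "F' 0 = 0" and "D \<le> 0"
proof -
  obtain d where d: "d > 0" "\<And>h. \<bar>h\<bar> < d \<Longrightarrow> (F has_field_derivative F' h) (at h)"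
      "\<And>h. \<bar>h\<bar> < d \<Longrightarrow> F h \<le> F 0"
    using eventually_conj[OF F mx] unfolding eventually_nhds_metric dist_real_def by auto
  show zero: "F' 0 = 0"
    using DERIV_local_max[OF d(2)[of 0] d(1)] d(1,3) by auto
  show "D \<le> 0"
  proof (rule ccontr)
    assume "\<not> D \<le> 0"
    then obtain e where e: "e > 0" "\<And>h. 0 < h \<Longrightarrow> h < e \<Longrightarrow> F' 0 < F' h"
      using DERIV_pos_inc_right[OF F'] by auto
    define h where "h = min d e / 2"
    have h: "0 < h" "h < d" "h < e" using d(1) e(1) by (auto simp: h_def min_def)
    have "\<exists>s>0. s < h \<and> F h - F 0 = (h - 0) * F' s"
      by (rule MVT2) (use h d(2) in auto)
    then obtain s where s: "0 < s" "s < h" "F h - F 0 = h * F' s" by auto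
    have "F' s > 0" using e(2)[of s] s h zero by auto
    with s h have "F h > F 0" by (smt (verit) mult_pos_pos)
    with d(3)[of h] h show False by auto
  qed
qed

text \<open>The existence of partial derivatives alone does not make directional derivatives linear in the
  direction. It is enough that one of the two partial derivatives is continuous at the point: the
  increment along \<open>e\<close> starts from the moving point \<open>z + h d\<close>, the mean value theorem evaluates
  \<open>G\<close> at a point that tends to \<open>z\<close>, and continuity of \<open>G\<close> gives the limit.\<close>

lemma line_derivative_add:
  fixes g G :: "'a::real_normed_vector \<Rightarrow> real"
  assumes g: "((\<lambda>h. g (z + h *\<^sub>R d)) has_field_derivative D) (at 0)"
    and G: "\<forall>\<^sub>F w in nhds z. ((\<lambda>h. g (w + h *\<^sub>R e)) has_field_derivative G w) (at 0)"
    and cont: "isCont G z"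
  shows "((\<lambda>h. g (z + h *\<^sub>R (d + c *\<^sub>R e))) has_field_derivative (D + c * G z)) (at 0)"
proof -
  obtain r where r: "r > 0" and Gr: "\<And>w. dist w z < r \<Longrightarrow> ((\<lambda>h. g (w + h *\<^sub>R e)) has_field_derivative G w) (at 0)"
    using G unfolding eventually_nhds_metric by auto
  define K where "K = norm d + \<bar>c\<bar> * norm e + 1"
  have K: "K > 0" unfolding K_def by (smt (verit) norm_ge_zero mult_nonneg_nonneg abs_ge_zero)
  \<comment> \<open>For fixed \<open>h\<close>, the parameter \<open>s\<close> runs through the step along \<open>e\<close>; \<open>k h 0\<close> is the value after the step along \<open>d\<close> only.\<close>
  define k where "k h s = g (z + h *\<^sub>R d + (s * (h * c)) *\<^sub>R e)" for h s
  have near: "dist (z + h *\<^sub>R d + (s * (h * c)) *\<^sub>R e) z \<le> \<bar>h\<bar> * K" if "0 \<le> s" "s \<le> 1" for h s :: real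
  proof -
    have "dist (z + h *\<^sub>R d + (s * (h * c)) *\<^sub>R e) z = norm (h *\<^sub>R d + (s * (h * c)) *\<^sub>R e)"
      by (simp add: dist_norm algebra_simps)
    also have "\<dots> \<le> \<bar>h\<bar> * norm d + (s * \<bar>h\<bar> * \<bar>c\<bar>) * norm e"
      by (rule order_trans[OF norm_triangle_ineq]) (use that in \<open>simp add: abs_mult\<close>)
    also have "\<dots> \<le> \<bar>h\<bar> * norm d + (1 * \<bar>h\<bar> * \<bar>c\<bar>) * norm e"
      by (intro add_left_mono mult_right_mono) (use that in auto)
    also have "\<dots> \<le> \<bar>h\<bar> * K" by (simp add: K_def algebra_simps)
    finally show ?thesis .
  qed
  have mvt: "\<exists>w. dist w z \<le> \<bar>h\<bar> * K \<and> k h 1 - k h 0 = h * c * G w" if h: "\<bar>h\<bar> * K < r" for h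
  proof -
    have der: "(k h has_field_derivative G (z + h *\<^sub>R d + (s * (h * c)) *\<^sub>R e) * (h * c)) (at s)"
      if s: "0 \<le> s" "s \<le> 1" for s
    proof -
      let ?w = "z + h *\<^sub>R d + (s * (h * c)) *\<^sub>R e"
      have "((\<lambda>x. g (?w + x *\<^sub>R e)) has_field_derivative G ?w) (at ((s - s) * (h * c)))"
        using Gr[of ?w] near[OF s, of h] h by simp
      moreover have "((\<lambda>x. (x - s) * (h * c)) has_field_derivative h * c) (at s)"
        by (auto intro!: derivative_eq_intros)
      ultimately have "((\<lambda>x. g (?w + ((x - s) * (h * c)) *\<^sub>R e)) has_field_derivative G ?w * (h * c)) (at s)"
        by (rule DERIV_chain2)
      moreover have "(\<lambda>x. g (?w + ((x - s) * (h * c)) *\<^sub>R e)) = k h"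
        by (simp add: k_def fun_eq_iff algebra_simps)
      ultimately show ?thesis by simp
    qed
    have "\<exists>s>0. s < 1 \<and> k h 1 - k h 0 = (1 - 0) * (G (z + h *\<^sub>R d + (s * (h * c)) *\<^sub>R e) * (h * c))"
      by (rule MVT2) (use der in auto)
    then obtain s where "0 < s" "s < 1" "k h 1 - k h 0 = (G (z + h *\<^sub>R d + (s * (h * c)) *\<^sub>R e) * (h * c))"
      by auto
    then show ?thesis using near[of s h] by (intro exI[of _ "z + h *\<^sub>R d + (s * (h * c)) *\<^sub>R e"]) auto
  qed
  have "((\<lambda>h. k h 1 - k h 0) has_field_derivative c * G z) (at 0)"
    unfolding DERIV_def
  proof (rule LIM_I)
    fix \<epsilon> :: real assume "\<epsilon> > 0"
    then have "\<epsilon> / (\<bar>c\<bar> + 1) > 0" by simp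
    then obtain \<delta> where \<delta>: "\<delta> > 0" "\<And>w. dist w z < \<delta> \<Longrightarrow> \<bar>G w - G z\<bar> < \<epsilon> / (\<bar>c\<bar> + 1)"
      using cont unfolding continuous_at_eps_delta dist_real_def by meson
    show "\<exists>s>0. \<forall>x. x \<noteq> 0 \<and> norm (x - 0) < s \<longrightarrow>
            norm ((k (0 + x) 1 - k (0 + x) 0 - (k 0 1 - k 0 0)) / x - c * G z) < \<epsilon>"
    proof (intro exI[of _ "min r \<delta> / K"] conjI allI impI)
      show "0 < min r \<delta> / K" using r \<delta>(1) K by simp
      fix x :: real assume x: "x \<noteq> 0 \<and> norm (x - 0) < min r \<delta> / K"
      then have xK: "\<bar>x\<bar> * K < r" "\<bar>x\<bar> * K < \<delta>" using K by (auto simp: field_simps)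
      obtain w where w: "dist w z \<le> \<bar>x\<bar> * K" "k x 1 - k x 0 = x * c * G w" using mvt[OF xK(1)] by blast
      have "(k (0 + x) 1 - k (0 + x) 0 - (k 0 1 - k 0 0)) / x - c * G z = c * (G w - G z)"
        using w(2) x by (simp add: k_def field_simps)
      moreover have "\<bar>c\<bar> * \<bar>G w - G z\<bar> \<le> \<bar>c\<bar> * (\<epsilon> / (\<bar>c\<bar> + 1))"
        using \<delta>(2)[of w] w(1) xK(2) by (intro mult_left_mono) auto
      moreover have "\<bar>c\<bar> * (\<epsilon> / (\<bar>c\<bar> + 1)) < \<epsilon>" using \<open>\<epsilon> > 0\<close> by (simp add: field_simps)
      ultimately show "norm ((k (0 + x) 1 - k (0 + x) 0 - (k 0 1 - k 0 0)) / x - c * G z) < \<epsilon>"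
        by (simp add: abs_mult)
    qed
  qed
  from DERIV_add[OF g this] show ?thesis
    by (simp add: k_def scaleR_add_right add.assoc)
qed

lemma line_derivative_sum:
  fixes g :: "'a::real_normed_vector \<Rightarrow> real" and e :: "'i \<Rightarrow> 'a"
  assumes "finite S"
    and der: "\<And>i. \<forall>\<^sub>F w in nhds z. ((\<lambda>h. g (w + h *\<^sub>R e i)) has_field_derivative G i w) (at 0)"
    and cont: "\<And>i. isCont (G i) z"
  shows "((\<lambda>h. g (z + h *\<^sub>R (\<Sum>i\<in>S. c i *\<^sub>R e i))) has_field_derivative (\<Sum>i\<in>S. c i * G i z)) (at 0)"
  using \<open>finite S\<close>
proof (induction S rule: finite_induct)
  case empty
  then show ?case by simp
next
  case (insert i S)
  from line_derivative_add[OF insert.IH der cont, of "c i" i] insert.hyps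
  show ?case by (simp add: add.commute)
qed

lemma spatial_vector_expansion:
  "((\<xi> :: real ^ 'n), 0 :: real) = (\<Sum>i\<in>UNIV. \<xi> $ i *\<^sub>R (axis i 1, 0))"
  using basis_expansion[of \<xi>]
  by (simp add: prod_eq_iff fst_sum snd_sum scalar_mult_eq_scaleR)

section \<open>The trace of a product of semidefinite matrices\<close>

text \<open>A positive semidefinite matrix is a sum of rank one matrices \<open>w w\<^sup>T\<close> with nonnegative
  weights, and the trace of \<open>w w\<^sup>T H\<close> is the value at \<open>w\<close> of the quadratic form of \<open>H\<close>.
  The rank one terms are split off one index at a time (Cholesky): subtracting
  \<open>w w\<^sup>T / A\<^sub>k\<^sub>k\<close>, with \<open>w\<close> the \<open>k\<close>-th column of \<open>A\<close>, clears row and column \<open>k\<close>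
  and preserves semidefiniteness; if \<open>A\<^sub>k\<^sub>k = 0\<close>, semidefiniteness makes the row vanish
  already. The induction is on a set of indices outside of which the rows of \<open>A\<close> vanish. Only the
  quadratic form of \<open>H\<close> is constrained, so that a matrix of mixed second derivatives can be inserted
  without an argument on the order of differentiation.\<close>

lemma trace_mult_nonpos:
  fixes A H :: "real ^ 'n ^ 'n"
  assumes sym: "transpose A = A"
    and psd: "\<And>\<xi>. 0 \<le> (A *v \<xi>) \<bullet> \<xi>"
    and neg: "\<And>\<xi>. (H *v \<xi>) \<bullet> \<xi> \<le> 0"
  shows "(\<Sum>i\<in>UNIV. \<Sum>j\<in>UNIV. A $ i $ j * H $ i $ j) \<le> 0"
proof -
  have "(\<Sum>i\<in>UNIV. \<Sum>j\<in>UNIV. A $ i $ j * H $ i $ j) \<le> 0"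
    if "finite S" "transpose A = A" "\<And>\<xi>. 0 \<le> (A *v \<xi>) \<bullet> \<xi>" "\<And>i j. i \<notin> S \<Longrightarrow> A $ i $ j = 0"
    for S and A :: "real ^ 'n ^ 'n"
    using that
  proof (induction S arbitrary: A rule: finite_induct)
    case empty
    then show ?case by simp
  next
    case (insert k S)
    have sy: "A $ i $ j = A $ j $ i" for i j
      using arg_cong[OF insert.prems(1), of "\<lambda>B. B $ i $ j"] by (simp add: transpose_def)
    define w where "w = A *v axis k 1"
    have w: "w $ i = A $ i $ k" for i by (simp add: w_def matrix_vector_mul_component inner_axis)
    have Aw: "(A *v \<xi>) $ k = w \<bullet> \<xi>" for \<xi>
      by (simp add: matrix_vector_mult_def inner_vec_def w sy[of k])
    have expand: "(A *v (\<xi> + s *\<^sub>R axis k 1)) \<bullet> (\<xi> + s *\<^sub>R axis k 1)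
        = (A *v \<xi>) \<bullet> \<xi> + 2 * s * (w \<bullet> \<xi>) + s\<^sup>2 * A $ k $ k" for \<xi> s
      by (simp add: matrix_vector_right_distrib matrix_vector_mult_scaleR inner_add_left inner_add_right
          inner_axis Aw w flip: w_def) (simp add: algebra_simps power2_eq_square)
    note q = insert.prems(2)[of "\<xi> + s *\<^sub>R axis k 1" for \<xi> s, unfolded expand]
    have Akk: "0 \<le> A $ k $ k" using q[of 0 1] by simp
    show ?case
    proof (cases "A $ k $ k = 0")
      case True
      have "w \<bullet> \<xi> = 0" for \<xi>
      proof (rule ccontr)
        assume n: "w \<bullet> \<xi> \<noteq> 0"
        \<comment> \<open>Otherwise the form is affine and not constant in \<open>s\<close>; at this \<open>s\<close> it equals \<open>-1\<close>.\<close>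
        then show False
          using q[of \<xi> "- ((A *v \<xi>) \<bullet> \<xi> + 1) / (2 * (w \<bullet> \<xi>))"] True by (simp add: field_simps)
      qed
      then have "w = 0" by (metis inner_eq_zero_iff)
      then have "A $ k $ j = 0" for j using w[of j] sy[of k j] by simp
      then show ?thesis
        by (intro insert.IH insert.prems(1,2)) (metis insert.prems(3) insert_iff)
    next
      case False
      define B :: "real ^ 'n ^ 'n" where "B = (\<chi> i j. A $ i $ j - w $ i * w $ j / A $ k $ k)"
      have Bv: "B *v \<xi> = A *v \<xi> - ((w \<bullet> \<xi>) / A $ k $ k) *\<^sub>R w" for \<xi>
        by (simp add: vec_eq_iff B_def matrix_vector_mult_def inner_vec_def sum_subtractf
            sum_distrib_right sum_distrib_left sum_divide_distrib algebra_simps)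
      have "(\<Sum>i\<in>UNIV. \<Sum>j\<in>UNIV. B $ i $ j * H $ i $ j) \<le> 0"
      proof (rule insert.IH)
        show "transpose B = B" by (simp add: B_def transpose_def vec_eq_iff sy mult.commute)
        show "0 \<le> (B *v \<xi>) \<bullet> \<xi>" for \<xi>
        proof -
          have "(B *v \<xi>) \<bullet> \<xi> = (A *v \<xi>) \<bullet> \<xi> - (w \<bullet> \<xi>)\<^sup>2 / A $ k $ k"
            by (simp add: Bv inner_diff_left power2_eq_square)
          \<comment> \<open>This is the minimum over \<open>s\<close> of the form at \<open>\<xi> + s e\<^sub>k\<close>.\<close>
          moreover have "0 \<le> (A *v \<xi>) \<bullet> \<xi> - (w \<bullet> \<xi>)\<^sup>2 / A $ k $ k"
            using q[of \<xi> "- (w \<bullet> \<xi>) / A $ k $ k"] False by (simp add: field_simps power2_eq_square)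
          ultimately show ?thesis by simp
        qed
        show "B $ i $ j = 0" if "i \<notin> S" for i j
        proof (cases "i = k")
          case True
          then show ?thesis using False by (simp add: B_def w sy[of k j])
        next
          case False
          then show ?thesis using insert.prems(3)[of i] that by (simp add: B_def w)
        qed
      qed
      moreover have "(\<Sum>i\<in>UNIV. \<Sum>j\<in>UNIV. A $ i $ j * H $ i $ j)
          = (\<Sum>i\<in>UNIV. \<Sum>j\<in>UNIV. B $ i $ j * H $ i $ j) + ((H *v w) \<bullet> w) / A $ k $ k"
        by (simp add: B_def matrix_vector_mult_def inner_vec_def sum_divide_distrib sum_distrib_left
            sum_distrib_right algebra_simps flip: sum.distrib)
      moreover have "((H *v w) \<bullet> w) / A $ k $ k \<le> 0"
        using neg Akk by (simp add: divide_nonpos_nonneg)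
      ultimately show ?thesis by linarith
    qed
  qed
  from this[OF finite[of UNIV] sym psd] show ?thesis by simp
qed

section \<open>Absolutely continuous functions\<close>

lemma abs_continuous_onE:
  assumes "abs_continuous_on a b g" and "\<epsilon> > 0"
  obtains \<delta> where "\<delta> > 0"
    and "\<forall>d S. d division_of S \<longrightarrow> S \<subseteq> {a..b} \<longrightarrow> (\<Sum>k\<in>d. Sup k - Inf k) < \<delta>
      \<longrightarrow> (\<Sum>k\<in>d. norm (g (Sup k) - g (Inf k))) < \<epsilon>"
proof -
  have "\<exists>\<delta>>0. \<forall>d S. d division_of S \<and> S \<subseteq> {a..b} \<and> (\<Sum>k\<in>d. Sup k - Inf k) < \<delta>
      \<longrightarrow> (\<Sum>k\<in>d. norm (g (Sup k) - g (Inf k))) < \<epsilon>"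
    using assms unfolding abs_continuous_on_def by simp
  then obtain \<delta> where "\<delta> > 0" and \<delta>: "\<forall>d S. d division_of S \<and> S \<subseteq> {a..b} \<and> (\<Sum>k\<in>d. Sup k - Inf k) < \<delta>
      \<longrightarrow> (\<Sum>k\<in>d. norm (g (Sup k) - g (Inf k))) < \<epsilon>" by (elim exE conjE)
  show thesis by (rule that[OF \<open>\<delta> > 0\<close>]) (intro allI impI \<delta>[rule_format] conjI)
qed

lemma abs_continuous_on_snd:
  assumes "abs_continuous_on a b g"
  shows "abs_continuous_on a b (\<lambda>s. snd (g s) :: real)"
  unfolding abs_continuous_on_def
proof (intro allI impI)
  fix \<epsilon> :: real assume "\<epsilon> > 0"
  obtain \<delta> where "\<delta> > 0" and \<delta>: "\<forall>d S. d division_of S \<longrightarrow> S \<subseteq> {a..b} \<longrightarrow>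
      (\<Sum>k\<in>d. Sup k - Inf k) < \<delta> \<longrightarrow> (\<Sum>k\<in>d. norm (g (Sup k) - g (Inf k))) < \<epsilon>"
    using abs_continuous_onE[OF assms \<open>\<epsilon> > 0\<close>] .
  have "(\<Sum>k\<in>d. norm (snd (g (Sup k)) - snd (g (Inf k)))) < \<epsilon>"
    if "d division_of S" "S \<subseteq> {a..b}" "(\<Sum>k\<in>d. Sup k - Inf k) < \<delta>" for d S
  proof -
    have "(\<Sum>k\<in>d. norm (snd (g (Sup k)) - snd (g (Inf k)))) \<le> (\<Sum>k\<in>d. norm (g (Sup k) - g (Inf k)))"
      by (intro sum_mono) (metis norm_snd_le prod.collapse snd_diff)
    also have "\<dots> < \<epsilon>" by (rule \<delta>[rule_format, OF that])
    finally show ?thesis .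
  qed
  with \<open>\<delta> > 0\<close> show "\<exists>\<delta>>0. \<forall>d S. d division_of S \<and> S \<subseteq> {a..b} \<and> (\<Sum>k\<in>d. Sup k - Inf k) < \<delta> \<longrightarrow>
      (\<Sum>k\<in>d. norm (snd (g (Sup k)) - snd (g (Inf k)))) < \<epsilon>" by (intro exI[of _ \<delta>] conjI allI impI) auto
qed

lemma abs_continuous_on_imp_continuous_on:
  fixes g :: "real \<Rightarrow> 'a::real_normed_vector"
  assumes "abs_continuous_on a b g"
  shows "continuous_on {a..b} g"
  unfolding continuous_on_iff
proof (intro ballI allI impI)
  fix x and \<epsilon> :: real assume x: "x \<in> {a..b}" and "\<epsilon> > 0"
  obtain \<delta> where "\<delta> > 0" and \<delta>: "\<forall>d S. d division_of S \<longrightarrow> S \<subseteq> {a..b} \<longrightarrow>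
      (\<Sum>k\<in>d. Sup k - Inf k) < \<delta> \<longrightarrow> (\<Sum>k\<in>d. norm (g (Sup k) - g (Inf k))) < \<epsilon>"
    using abs_continuous_onE[OF assms \<open>\<epsilon> > 0\<close>] .
  have *: "norm (g q - g p) < \<epsilon>" if "p \<in> {a..b}" "q \<in> {a..b}" "p \<le> q" "q - p < \<delta>" for p q
  proof -
    have "{{p..q}} division_of {p..q}" using division_of_self[of p q] that by auto
    from \<delta>[rule_format, OF this] that show ?thesis by auto
  qed
  show "\<exists>d>0. \<forall>x'\<in>{a..b}. dist x' x < d \<longrightarrow> dist (g x') (g x) < \<epsilon>"
  proof (intro exI[of _ \<delta>] conjI ballI impI \<open>\<delta> > 0\<close>)
    fix y assume y: "y \<in> {a..b}" "dist y x < \<delta>"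
    then show "dist (g y) (g x) < \<epsilon>"
      using *[of x y] *[of y x] x by (cases "x \<le> y") (auto simp: dist_norm norm_minus_commute)
  qed
qed

lemma negligible_imp_small_open_superset:
  fixes N :: "'a::euclidean_space set"
  assumes "negligible N" "e > 0"
  obtains U where "open U" "N \<subseteq> U" "U \<in> lmeasurable" "measure lebesgue U < e"
proof -
  have N: "N \<in> sets lebesgue" "emeasure lebesgue N = 0"
    using assms(1) by (auto simp: negligible_iff_null_sets)
  obtain U where U: "open U" "N \<subseteq> U" "U - N \<in> lmeasurable" "emeasure lebesgue (U - N) < ennreal e"
    using sets_lebesgue_outer_open[OF N(1) assms(2)] by metis
  have "N \<in> lmeasurable" using assms(1) by (simp add: negligible_imp_measurable)
  then have "U \<in> lmeasurable" using U by (metis Diff_partition fmeasurable.Un)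
  moreover have "measure lebesgue U = measure lebesgue (U - N)"
    using assms(1) U \<open>U \<in> lmeasurable\<close> \<open>N \<in> lmeasurable\<close>
    by (simp add: measurable_measure_Diff fmeasurableD negligible_imp_measure0)
  moreover have "measure lebesgue (U - N) < e"
    using U(4) U(3) assms(2) by (simp add: emeasure_eq_measure2 ennreal_less_iff)
  ultimately show thesis using that U by auto
qed

lemma tagged_partial_division_sum_length_le_measure:
  fixes p :: "(real \<times> real set) set"
  assumes p: "p tagged_partial_division_of {a..b}" and U: "U \<in> lmeasurable"
    and sub: "\<And>x K. (x, K) \<in> p \<Longrightarrow> K \<subseteq> U"
  shows "(\<Sum>K\<in>snd ` p. Sup K - Inf K) \<le> measure lebesgue U"
proof -
  have d: "snd ` p division_of \<Union>(snd ` p)" by (rule partial_division_of_tagged_division[OF p])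
  have iv: "\<exists>u v. K = {u..v} \<and> u \<le> v" if "K \<in> snd ` p" for K
    using division_ofD(3,4)[OF d that] by auto
  have "(\<Sum>K\<in>snd ` p. Sup K - Inf K) = (\<Sum>K\<in>snd ` p. measure lebesgue K)"
  proof (rule sum.cong[OF refl])
    fix K assume "K \<in> snd ` p"
    then show "Sup K - Inf K = measure lebesgue K" using iv[of K] by auto
  qed
  also have "\<dots> = measure lebesgue (\<Union>(snd ` p))"
  proof (rule measure_negligible_finite_Union[symmetric])
    show "pairwise (\<lambda>S T. negligible (S \<inter> T)) (snd ` p)"
      using d unfolding pairwise_def
      by (metis division_ofD(4,5) negligible_convex_interior convex_Int convex_box(1) interior_Int)
  qed (use d in auto)
  also have "\<dots> \<le> measure lebesgue U"
  proof (rule measure_mono_fmeasurable[OF _ _ U])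
    show "\<Union>(snd ` p) \<subseteq> U" using sub by force
    show "\<Union>(snd ` p) \<in> sets lebesgue"
      using division_ofD(1)[OF d] iv by (intro sets.finite_Union) force+
  qed
  finally show ?thesis .
qed

text \<open>Cousin's lemma replaces the usual covering argument. Take a tagged division that is fine for the
  following gauge: at a point \<open>x\<close> outside \<open>N\<close>, so small that the increments of \<open>h\<close> from \<open>x\<close>
  are at most \<open>\<epsilon>\<close> times those of the argument; at a point of \<open>N\<close>, so small that the interval stays
  in an open superset \<open>U\<close> of \<open>N\<close> of measure less than \<open>\<delta>\<close>. The intervals of the first kind
  contribute at most \<open>\<epsilon> (b - a)\<close> to \<open>h b - h a\<close>, and absolute continuity bounds the
  contribution of the second kind by \<open>\<epsilon>\<close>.\<close>

lemma abs_continuous_on_zero_derivative_AE_imp_const: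
  fixes h :: "real \<Rightarrow> real"
  assumes ac: "abs_continuous_on a b h" and ab: "a \<le> b"
    and neg: "negligible N"
    and der: "\<And>x. x \<in> {a..b} - N \<Longrightarrow> (h has_vector_derivative 0) (at x within {a..b})"
  shows "h b = h a"
proof -
  have "\<bar>h b - h a\<bar> \<le> \<epsilon> * (1 + (b - a))" if "\<epsilon> > 0" for \<epsilon>
  proof -
    obtain \<delta> where "\<delta> > 0" and \<delta>: "\<forall>d S. d division_of S \<longrightarrow> S \<subseteq> {a..b} \<longrightarrow>
      (\<Sum>k\<in>d. Sup k - Inf k) < \<delta> \<longrightarrow> (\<Sum>k\<in>d. norm (h (Sup k) - h (Inf k))) < \<epsilon>"
      using abs_continuous_onE[OF ac \<open>\<epsilon> > 0\<close>] .
    obtain U where U: "open U" "N \<subseteq> U" "U \<in> lmeasurable" "measure lebesgue U < \<delta>"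
      using negligible_imp_small_open_superset[OF neg \<open>\<delta> > 0\<close>] .
    have "\<exists>r>0. (x \<in> N \<longrightarrow> ball x r \<subseteq> U) \<and>
        (x \<notin> N \<longrightarrow> (\<forall>y\<in>{a..b} \<inter> ball x r. \<bar>h y - h x\<bar> \<le> \<epsilon> * \<bar>y - x\<bar>))" if x: "x \<in> {a..b}" for x
    proof (cases "x \<in> N")
      case True
      then show ?thesis using U(1,2) by (meson open_contains_ball subsetD)
    next
      case False
      from der[of x] x False have "(h has_derivative (\<lambda>y. 0)) (at x within {a..b})"
        by (simp add: has_vector_derivative_def)
      then obtain r where "r > 0" "\<forall>y\<in>{a..b}. norm (y - x) < r \<longrightarrow> norm (h y - h x - 0) \<le> \<epsilon> * norm (y - x)"
        using \<open>\<epsilon> > 0\<close> unfolding has_derivative_within_alt by blast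
      then show ?thesis using False
        by (intro exI[of _ r]) (auto simp: dist_real_def abs_minus_commute)
    qed
    then obtain r where r: "\<And>x. x \<in> {a..b} \<Longrightarrow> r x > 0"
        "\<And>x. x \<in> {a..b} \<Longrightarrow> x \<in> N \<Longrightarrow> ball x (r x) \<subseteq> U"
        "\<And>x y. x \<in> {a..b} \<Longrightarrow> x \<notin> N \<Longrightarrow> y \<in> {a..b} \<Longrightarrow> y \<in> ball x (r x) \<Longrightarrow> \<bar>h y - h x\<bar> \<le> \<epsilon> * \<bar>y - x\<bar>"
      by (metis IntI)
    define g where "g x = ball x (if x \<in> {a..b} then r x else 1)" for x
    have "gauge g" using r(1) by (auto simp: gauge_def g_def)
    then obtain p where p: "p tagged_division_of {a..b}" "g fine p"
      using fine_division_exists_real by blast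
    have fin: "finite p" using p(1) by blast
    have mem: "x \<in> K \<and> K \<subseteq> {a..b} \<and> K \<subseteq> ball x (r x) \<and> (\<exists>u v. K = {u..v} \<and> u \<le> v)" if xK: "(x, K) \<in> p" for x K
    proof -
      have "x \<in> K" "K \<subseteq> {a..b}" using tagged_division_ofD(2,3)[OF p(1) that] by auto
      moreover obtain u v where "K = {u..v}" using tagged_division_ofD(4)[OF p(1) xK] by auto
      moreover have "K \<subseteq> g x" using p(2) that by (auto simp: fine_def)
      ultimately show ?thesis by (auto simp: g_def split: if_splits)
    qed
    let ?D = "\<lambda>K. h (Sup K) - h (Inf K)"
    define q where "q = {xK \<in> p. fst xK \<in> N}"
    have qp: "q tagged_partial_division_of {a..b}"
      using p(1) tagged_partial_division_subset[of p "{a..b}" q] by (auto simp: q_def tagged_division_of_def)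
    have bad: "(\<Sum>(x,K)\<in>q. \<bar>?D K\<bar>) < \<epsilon>"
    proof -
      have "(\<Sum>K\<in>snd ` q. Sup K - Inf K) \<le> measure lebesgue U"
      proof (rule tagged_partial_division_sum_length_le_measure[OF qp U(3)])
        fix x K assume "(x, K) \<in> q"
        then have "x \<in> {a..b}" "x \<in> N" "K \<subseteq> ball x (r x)" using mem[of x K] by (auto simp: q_def)
        then show "K \<subseteq> U" using r(2)[of x] by blast
      qed
      then have "(\<Sum>K\<in>snd ` q. norm (?D K)) < \<epsilon>"
        using U(4) tagged_partial_division_ofD(3)[OF qp]
        by (intro \<delta>[rule_format, OF partial_division_of_tagged_division[OF qp]]) force+
      moreover have "(\<Sum>(x,K)\<in>q. \<bar>?D K\<bar>) = (\<Sum>K\<in>snd ` q. \<bar>?D K\<bar>)"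
      proof -
        \<comment> \<open>The lemma on sums over tagged divisions also asks for the value at the empty interval, where \<open>Sup\<close> and \<open>Inf\<close> are arbitrary.\<close>
        let ?E = "\<lambda>K. if K = {} then 0 else \<bar>?D K\<bar>"
        have ne: "K \<noteq> {}" if "(x, K) \<in> q" for x K using tagged_partial_division_ofD(2)[OF qp that] by auto
        have "(\<Sum>(x,K)\<in>q. \<bar>?D K\<bar>) = (\<Sum>(x,K)\<in>q. ?E K)"
          using ne by (intro sum.cong) auto
        also have "\<dots> = (\<Sum>K\<in>snd ` q. ?E K)"
        proof (rule sum.over_tagged_division_lemma[OF tagged_partial_division_of_Union_self[OF qp]])
          fix u v :: real assume "box u v = {}"
          then have "v \<le> u" by (simp add: box_eq_empty)
          then show "?E (cbox u v) = 0" by (cases "u = v") auto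
        qed
        also have "\<dots> = (\<Sum>K\<in>snd ` q. \<bar>?D K\<bar>)"
          using ne by (intro sum.cong) auto
        finally show ?thesis .
      qed
      ultimately show ?thesis by simp
    qed
    have good: "(\<Sum>(x,K)\<in>p - q. \<bar>?D K\<bar>) \<le> \<epsilon> * (b - a)"
    proof -
      have "(\<Sum>(x,K)\<in>p - q. \<bar>?D K\<bar>) \<le> (\<Sum>(x,K)\<in>p - q. \<epsilon> * (Sup K - Inf K))"
      proof (rule sum_mono, clarify)
        fix x K assume xK: "(x, K) \<in> p" "(x, K) \<notin> q"
        then obtain u v where uv: "K = {u..v}" "u \<le> v" "x \<in> K" "K \<subseteq> {a..b}" "K \<subseteq> ball x (r x)" "x \<notin> N"
          using mem[of x K] by (auto simp: q_def)
        have "u \<in> K" "v \<in> K" using uv by auto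
        then have "\<bar>h v - h x\<bar> \<le> \<epsilon> * \<bar>v - x\<bar>" "\<bar>h u - h x\<bar> \<le> \<epsilon> * \<bar>u - x\<bar>"
          using uv by (intro r(3); blast)+
        then have "\<bar>h v - h u\<bar> \<le> \<epsilon> * (v - x) + \<epsilon> * (x - u)" using uv by auto
        then show "\<bar>?D K\<bar> \<le> \<epsilon> * (Sup K - Inf K)" using uv by (simp add: algebra_simps)
      qed
      also have "\<dots> \<le> (\<Sum>(x,K)\<in>p. \<epsilon> * (Sup K - Inf K))"
        using mem \<open>\<epsilon> > 0\<close> by (intro sum_mono2 fin) (force simp: split_beta)+
      also have "\<dots> = \<epsilon> * (\<Sum>(x,K)\<in>p. Sup K - Inf K)"
        by (simp add: sum_distrib_left split_beta)
      also have "(\<Sum>(x,K)\<in>p. Sup K - Inf K) = b - a"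
        using additive_tagged_division_1[OF ab p(1), of "\<lambda>x. x"] by simp
      finally show ?thesis .
    qed
    have "h b - h a = (\<Sum>(x,K)\<in>p. ?D K)"
      using additive_tagged_division_1[OF ab p(1), of h] by simp
    then have "\<bar>h b - h a\<bar> \<le> (\<Sum>(x,K)\<in>p. \<bar>?D K\<bar>)"
      using sum_abs[of "\<lambda>(x,K). ?D K" p] by (simp add: split_beta)
    also have "\<dots> = (\<Sum>(x,K)\<in>p - q. \<bar>?D K\<bar>) + (\<Sum>(x,K)\<in>q. \<bar>?D K\<bar>)"
      by (rule sum.subset_diff) (use fin in \<open>auto simp: q_def\<close>)
    also have "\<dots> \<le> \<epsilon> * (1 + (b - a))" using bad good by (simp add: algebra_simps)
    finally show ?thesis .
  qed
  note est = this
  show ?thesis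
  proof (rule ccontr)
    assume ne: "h b \<noteq> h a"
    let ?e = "\<bar>h b - h a\<bar> / (2 * (1 + (b - a)))"
    have "?e > 0" using ne ab by simp
    from est[OF this] have "\<bar>h b - h a\<bar> \<le> ?e * (1 + (b - a))" .
    also have "\<dots> = \<bar>h b - h a\<bar> / 2"
      using ab by (simp add: divide_simps)
    finally show False using ne by simp
  qed
qed

lemma abs_continuous_on_subinterval:
  assumes "abs_continuous_on a b g" "{c..d} \<subseteq> {a..b}"
  shows "abs_continuous_on c d g"
  unfolding abs_continuous_on_def
proof (intro allI impI)
  fix \<epsilon> :: real assume "\<epsilon> > 0"
  obtain \<delta> where "\<delta> > 0" and \<delta>: "\<forall>d S. d division_of S \<longrightarrow> S \<subseteq> {a..b} \<longrightarrow>
      (\<Sum>k\<in>d. Sup k - Inf k) < \<delta> \<longrightarrow> (\<Sum>k\<in>d. norm (g (Sup k) - g (Inf k))) < \<epsilon>"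
    using abs_continuous_onE[OF assms(1) \<open>\<epsilon> > 0\<close>] .
  show "\<exists>\<delta>>0. \<forall>D S. D division_of S \<and> S \<subseteq> {c..d} \<and> (\<Sum>k\<in>D. Sup k - Inf k) < \<delta> \<longrightarrow>
      (\<Sum>k\<in>D. norm (g (Sup k) - g (Inf k))) < \<epsilon>"
    using \<open>\<delta> > 0\<close> assms(2) by (intro exI[of _ \<delta>] conjI allI impI \<delta>[rule_format]) auto
qed

lemma abs_continuous_on_add_id:
  fixes g :: "real \<Rightarrow> real"
  assumes "abs_continuous_on a b g"
  shows "abs_continuous_on a b (\<lambda>s. g s + s)"
  unfolding abs_continuous_on_def
proof (intro allI impI)
  fix \<epsilon> :: real assume "\<epsilon> > 0"
  then have "\<epsilon> / 2 > 0" by simp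
  obtain \<delta> where "\<delta> > 0" and \<delta>: "\<forall>d S. d division_of S \<longrightarrow> S \<subseteq> {a..b} \<longrightarrow>
      (\<Sum>k\<in>d. Sup k - Inf k) < \<delta> \<longrightarrow> (\<Sum>k\<in>d. norm (g (Sup k) - g (Inf k))) < \<epsilon> / 2"
    using abs_continuous_onE[OF assms(1) \<open>\<epsilon> / 2 > 0\<close>] .
  have "(\<Sum>k\<in>d. norm (g (Sup k) + Sup k - (g (Inf k) + Inf k))) < \<epsilon>"
    if d: "d division_of S" and S: "S \<subseteq> {a..b}" and len: "(\<Sum>k\<in>d. Sup k - Inf k) < min \<delta> (\<epsilon> / 2)" for d S
  proof -
    have "Inf k \<le> Sup k" if "k \<in> d" for k using division_ofD(3,4)[OF d that] by auto
    then have "(\<Sum>k\<in>d. norm (g (Sup k) + Sup k - (g (Inf k) + Inf k)))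
        \<le> (\<Sum>k\<in>d. norm (g (Sup k) - g (Inf k)) + (Sup k - Inf k))"
      by (intro sum_mono) force
    also have "\<dots> = (\<Sum>k\<in>d. norm (g (Sup k) - g (Inf k))) + (\<Sum>k\<in>d. Sup k - Inf k)"
      by (rule sum.distrib)
    also have "\<dots> < \<epsilon>" using \<delta>[rule_format, OF d S] len by simp
    finally show ?thesis .
  qed
  then show "\<exists>\<delta>>0. \<forall>d S. d division_of S \<and> S \<subseteq> {a..b} \<and> (\<Sum>k\<in>d. Sup k - Inf k) < \<delta> \<longrightarrow>
      (\<Sum>k\<in>d. norm (g (Sup k) + Sup k - (g (Inf k) + Inf k))) < \<epsilon>"
    using \<open>\<delta> > 0\<close> \<open>\<epsilon> > 0\<close> by (intro exI[of _ "min \<delta> (\<epsilon> / 2)"] conjI allI impI) auto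
qed

section \<open>Solutions in nondivergence form\<close>

lemma sum_axis_mult: "(\<Sum>i\<in>UNIV. axis j (1 :: real) $ i * c i) = c j"
  by (simp add: axis_def if_distrib[where f="\<lambda>x. x * _"] cong: if_cong)

text \<open>A solution of the equation in nondivergence form. The derivatives of \<open>u\<close> are separate
  parameters: \<open>p\<close> for the spatial gradient, \<open>H\<close> for the second spatial derivatives and \<open>q\<close>
  for the time derivative. They are constrained only on \<open>\<Omega>\<close>, so the change of sign
  \<open>u \<mapsto> - u\<close>, which reduces minima to maxima, simply negates them and no statement
  about a derivative operator outside \<open>\<Omega>\<close> arises.\<close>

locale nondivergence_solution =
  fixes \<Omega> :: "'n::finite spacetime set"
    and a :: "'n spacetime \<Rightarrow> real ^ 'n ^ 'n" and \<beta> :: "'n spacetime \<Rightarrow> real ^ 'n"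
    and l L B :: real
    and u f q :: "'n spacetime \<Rightarrow> real" and p :: "'n \<Rightarrow> 'n spacetime \<Rightarrow> real"
    and H :: "'n \<Rightarrow> 'n \<Rightarrow> 'n spacetime \<Rightarrow> real"
  assumes open_domain: "open \<Omega>"
    and symmetric: "transpose (a z) = a z"
    and l_pos: "0 < l"
    and lower: "l * (norm \<xi>)\<^sup>2 \<le> (a z *v \<xi>) \<bullet> \<xi>"
    and upper: "(a z *v \<xi>) \<bullet> \<xi> \<le> L * (norm \<xi>)\<^sup>2"
    and drift: "norm (\<beta> z) \<le> B"
    and continuous_u: "continuous_on \<Omega> u"
    and continuous_p: "continuous_on \<Omega> (p j)"
    and continuous_H: "continuous_on \<Omega> (H i j)"
    and derivative_u: "z \<in> \<Omega> \<Longrightarrow> ((\<lambda>h. u (z + h *\<^sub>R (axis j 1, 0))) has_field_derivative p j z) (at 0)"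
    and derivative_p: "z \<in> \<Omega> \<Longrightarrow> ((\<lambda>h. p j (z + h *\<^sub>R (axis i 1, 0))) has_field_derivative H i j z) (at 0)"
    and derivative_t: "z \<in> \<Omega> \<Longrightarrow> ((\<lambda>h. u (z + h *\<^sub>R (0, 1))) has_field_derivative q z) (at 0)"
    and equation: "z \<in> \<Omega> \<Longrightarrow>
      (\<Sum>i\<in>UNIV. \<Sum>j\<in>UNIV. a z $ i $ j * H i j z) + (\<Sum>j\<in>UNIV. \<beta> z $ j * p j z) - q z = f z"
begin

lemma eventually_in_domain:
  assumes "z \<in> \<Omega>" shows "\<forall>\<^sub>F w in nhds z. w \<in> \<Omega>"
  using open_domain assms by (rule eventually_nhds_in_open)

lemma eventually_line_in_domain:
  assumes "z \<in> \<Omega>" shows "\<forall>\<^sub>F h in nhds (0::real). z + h *\<^sub>R d \<in> \<Omega>"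
proof -
  have "((\<lambda>h::real. z + h *\<^sub>R d) \<longlongrightarrow> z + 0 *\<^sub>R d) (nhds 0)"
    by (intro tendsto_intros filterlim_ident)
  then show ?thesis
    using eventually_in_domain[OF assms] unfolding filterlim_iff by auto
qed

lemma spatial_derivative_u:
  assumes "z \<in> \<Omega>"
  shows "((\<lambda>h. u (z + h *\<^sub>R (\<xi>, 0))) has_field_derivative (\<Sum>j\<in>UNIV. \<xi> $ j * p j z)) (at 0)"
  unfolding spatial_vector_expansion[of \<xi>]
proof (rule line_derivative_sum)
  show "\<forall>\<^sub>F w in nhds z. ((\<lambda>h. u (w + h *\<^sub>R (axis i 1, 0))) has_field_derivative p i w) (at 0)" for i
    using eventually_in_domain[OF assms] by eventually_elim (rule derivative_u)
  show "isCont (p i) z" for i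
    using continuous_p open_domain assms by (simp add: continuous_on_eq_continuous_at)
qed simp

lemma spatial_derivative_p:
  assumes "z \<in> \<Omega>"
  shows "((\<lambda>h. p j (z + h *\<^sub>R (\<xi>, 0))) has_field_derivative (\<Sum>i\<in>UNIV. \<xi> $ i * H i j z)) (at 0)"
  unfolding spatial_vector_expansion[of \<xi>]
proof (rule line_derivative_sum)
  show "\<forall>\<^sub>F w in nhds z. ((\<lambda>h. p j (w + h *\<^sub>R (axis i 1, 0))) has_field_derivative H i j w) (at 0)" for i
    using eventually_in_domain[OF assms] by eventually_elim (rule derivative_p)
  show "isCont (H i j) z" for i
    using continuous_H open_domain assms by (simp add: continuous_on_eq_continuous_at)
qed simp

text \<open>The first and second order conditions along \<open>\<xi>\<close> at a contact point \<open>z\<close>, where \<open>u\<close> plus a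
  barrier has a local maximum. The barrier enters through its restriction \<open>\<psi>\<close> to the line.\<close>

lemma spatial_max_test:
  assumes z: "z \<in> \<Omega>"
    and \<psi>: "\<And>h. (\<psi> has_field_derivative \<psi>' h) (at h)"
    and \<psi>': "(\<psi>' has_field_derivative D) (at 0)"
    and mx: "\<forall>\<^sub>F h in nhds 0. u (z + h *\<^sub>R (\<xi>, 0)) + \<psi> h \<le> u z + \<psi> 0"
  shows "(\<Sum>j\<in>UNIV. \<xi> $ j * p j z) + \<psi>' 0 = 0"
    and "(\<Sum>j\<in>UNIV. \<xi> $ j * (\<Sum>i\<in>UNIV. \<xi> $ i * H i j z)) + D \<le> 0"
proof -
  let ?F = "\<lambda>h. u (z + h *\<^sub>R (\<xi>, 0)) + \<psi> h"
  let ?F' = "\<lambda>h. (\<Sum>j\<in>UNIV. \<xi> $ j * p j (z + h *\<^sub>R (\<xi>, 0))) + \<psi>' h"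
  have 1: "\<forall>\<^sub>F h in nhds 0. (?F has_field_derivative ?F' h) (at h)"
    using eventually_line_in_domain[OF z, of "(\<xi>, 0)"]
  proof eventually_elim
    case (elim h)
    have "((\<lambda>k. u (z + (k + h) *\<^sub>R (\<xi>, 0))) has_field_derivative
        (\<Sum>j\<in>UNIV. \<xi> $ j * p j (z + h *\<^sub>R (\<xi>, 0)))) (at 0)"
      using spatial_derivative_u[OF elim, of \<xi>] by (simp add: algebra_simps)
    then have "((\<lambda>k. u (z + k *\<^sub>R (\<xi>, 0))) has_field_derivative
        (\<Sum>j\<in>UNIV. \<xi> $ j * p j (z + h *\<^sub>R (\<xi>, 0)))) (at h)"
      using DERIV_shift[of "\<lambda>k. u (z + k *\<^sub>R (\<xi>, 0))" _ 0 h] by simp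
    then show ?case by (rule DERIV_add[OF _ \<psi>])
  qed
  have 2: "(?F' has_field_derivative (\<Sum>j\<in>UNIV. \<xi> $ j * (\<Sum>i\<in>UNIV. \<xi> $ i * H i j z)) + D) (at 0)"
    by (intro DERIV_add \<psi>' DERIV_sum DERIV_cmult spatial_derivative_p[OF z])
  have 3: "\<forall>\<^sub>F h in nhds 0. ?F h \<le> ?F 0" using mx by (simp flip: zero_prod_def)
  show "(\<Sum>j\<in>UNIV. \<xi> $ j * p j z) + \<psi>' 0 = 0"
    using second_derivative_nonpos_at_local_max(1)[OF 1 2 3] by (simp flip: zero_prod_def)
  show "(\<Sum>j\<in>UNIV. \<xi> $ j * (\<Sum>i\<in>UNIV. \<xi> $ i * H i j z)) + D \<le> 0"
    using second_derivative_nonpos_at_local_max(2)[OF 1 2 3] by (simp flip: zero_prod_def)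
qed

lemma psd: "0 \<le> (a z *v \<xi>) \<bullet> \<xi>"
  using lower[of \<xi> z] l_pos by (smt (verit) mult_nonneg_nonneg zero_le_power2)

text \<open>At an interior maximum the first derivatives vanish and the second order part is nonpositive,
  so the equation gives \<open>f z \<le> 0\<close>.\<close>

lemma source_zero_at_max:
  assumes z: "z \<in> \<Omega>" and mx: "\<And>w. w \<in> \<Omega> \<Longrightarrow> u w \<le> u z" and f: "0 \<le> f z"
  shows "f z = 0"
proof -
  have ev: "\<forall>\<^sub>F h in nhds 0. u (z + h *\<^sub>R d) \<le> u z" for d
    using eventually_line_in_domain[OF z, of d] by eventually_elim (rule mx)
  have sp: "(\<Sum>j\<in>UNIV. \<xi> $ j * p j z) = 0" "(\<Sum>j\<in>UNIV. \<xi> $ j * (\<Sum>i\<in>UNIV. \<xi> $ i * H i j z)) \<le> 0" for \<xi>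
    using spatial_max_test[OF z, of "\<lambda>_. 0" "\<lambda>_. 0" 0 \<xi>] ev[of "(\<xi>, 0)"] by simp_all
  have p: "p j z = 0" for j
    using sp(1)[of "axis j 1"] by (simp add: sum_axis_mult)
  have q: "q z = 0"
  proof -
    obtain d where "d > 0" "\<And>h. \<bar>h\<bar> < d \<Longrightarrow> u (z + h *\<^sub>R (0, 1)) \<le> u z"
      using ev[of "(0, 1)"] unfolding eventually_nhds_metric dist_real_def by auto
    then show ?thesis
      by (intro DERIV_local_max[OF derivative_t[OF z], of d]) (auto simp flip: zero_prod_def)
  qed
  have "((\<chi> i j. H i j z) *v \<xi>) \<bullet> \<xi> = (\<Sum>j\<in>UNIV. \<xi> $ j * (\<Sum>i\<in>UNIV. \<xi> $ i * H i j z))" for \<xi>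
    by (simp add: matrix_vector_mult_def inner_vec_def sum_distrib_left sum_distrib_right,
        subst sum.swap, simp add: mult_ac)
  then have "(\<Sum>i\<in>UNIV. \<Sum>j\<in>UNIV. a z $ i $ j * (\<chi> i j. H i j z) $ i $ j) \<le> 0"
    by (intro trace_mult_nonpos symmetric psd) (simp add: sp(2))
  then have "f z \<le> 0" using equation[OF z] by (simp add: p q)
  with f show ?thesis by simp
qed

end

section \<open>Propagation of maxima along segments\<close>

context nondivergence_solution
begin

text \<open>Suppose \<open>u < m\<close> at the early endpoint \<open>z2\<close>. Around the segment, whose position at time
  \<open>t\<close> is \<open>X t\<close>, lies a slanted tube of small radius \<open>r\<close> inside \<open>\<Omega>\<close>. In the coordinate
  \<open>y = x - X t\<close> the barrier is
  \<open>\<phi> y t = E0 exp (- k (t - t2)) (r\<^sup>2 - |y|\<^sup>2)\<^sup>2\<close>.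
  It vanishes on the lateral boundary and for small \<open>E0\<close> it keeps \<open>u + \<phi> \<le> m\<close> on the
  bottom, while \<open>u + \<phi> > m\<close> at \<open>z1\<close>. So \<open>u + \<phi>\<close> attains its maximum over the tube at a
  point that is in the interior or on the top.\<close>

text \<open>There the maximum conditions and \<open>f \<ge> 0\<close> force the operator applied to \<open>\<phi>\<close> to be nonpositive.
  But with \<open>\<rho> = r\<^sup>2 - |y|\<^sup>2\<close> that value is, up to a positive factor, at least
  \<open>8 l r\<^sup>2 - C \<rho> + k \<rho>\<^sup>2\<close>, where \<open>C\<close> collects the bounds on the trace, the
  drift and the slope of the segment, and the loss \<open>8 l \<rho>\<close> from \<open>|y|\<^sup>2 = r\<^sup>2 - \<rho>\<close>. The first term, which comes from ellipticity, wins where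
  \<open>\<rho>\<close> is small, and the last one, which comes from the decay in time, where it is not. The
  choice of \<open>k\<close> makes the discriminant negative, so the value is positive for every \<open>\<rho>\<close>.\<close>

lemma max_propagates_along_segment:
  assumes mx: "\<And>w. w \<in> \<Omega> \<Longrightarrow> u w \<le> m" and f: "\<And>w. w \<in> \<Omega> \<Longrightarrow> 0 \<le> f w"
    and seg: "closed_segment z1 z2 \<subseteq> \<Omega>" and time: "snd z2 < snd z1" and top: "u z1 = m"
  shows "u z2 = m"
proof (rule ccontr)
  assume "u z2 \<noteq> m"
  have z12: "z1 \<in> \<Omega>" "z2 \<in> \<Omega>" using seg by auto
  have less: "u z2 < m" using mx[OF z12(2)] \<open>u z2 \<noteq> m\<close> by simp
  obtain x1 t1 x2 t2 where z: "z1 = (x1, t1)" "z2 = (x2, t2)" by (metis prod.collapse)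
  with time have t12: "t2 < t1" by simp
  define v where "v = (1 / (t1 - t2)) *\<^sub>R (x1 - x2)"
  define X where "X t = x2 + (t - t2) *\<^sub>R v" for t
  have X1: "X t1 = x1" and X2: "X t2 = x2" using t12 by (simp_all add: X_def v_def)
  have X_seg: "(X t, t) \<in> closed_segment z1 z2" if "t2 \<le> t" "t \<le> t1" for t
  proof -
    define \<theta> where "\<theta> = (t1 - t) / (t1 - t2)"
    have "\<theta> * (t1 - t2) = t1 - t" using t12 by (simp add: \<theta>_def)
    then have "t = (1 - \<theta>) * t1 + \<theta> * t2" by (simp add: algebra_simps)
    moreover have "(t - t2) / (t1 - t2) = 1 - \<theta>" using t12 by (simp add: \<theta>_def field_simps)
    then have "X t = x2 + (1 - \<theta>) *\<^sub>R (x1 - x2)"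
      by (simp add: X_def v_def)
    then have "X t = (1 - \<theta>) *\<^sub>R x1 + \<theta> *\<^sub>R x2" by (simp add: algebra_simps)
    ultimately have "(X t, t) = (1 - \<theta>) *\<^sub>R z1 + \<theta> *\<^sub>R z2" by (simp add: z)
    moreover have "0 \<le> \<theta>" "\<theta> \<le> 1" using that t12 by (auto simp: \<theta>_def)
    ultimately show ?thesis unfolding closed_segment_def by blast
  qed
  obtain e where e: "e > 0" "(\<Union>w\<in>closed_segment z1 z2. ball w e) \<subseteq> \<Omega>"
    using compact_subset_open_imp_ball_epsilon_subset[OF compact_segment open_domain seg] .
  define \<delta> where "\<delta> = (m - u z2) / 2"
  have "\<delta> > 0" using less by (simp add: \<delta>_def)
  have "isCont u z2"
    using continuous_u open_domain z12 by (simp add: continuous_on_eq_continuous_at)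
  then obtain d where d: "d > 0" "\<And>w. dist w z2 < d \<Longrightarrow> \<bar>u w - u z2\<bar> < \<delta>"
    using \<open>\<delta> > 0\<close> unfolding continuous_at_eps_delta dist_real_def by metis
  define r where "r = min e d / 2"
  have r: "r > 0" "r < e" "r < d" using e d by (auto simp: r_def)
  define n where "n = real CARD('n)"
  define C where "C = 8 * l + 4 * n * L + 4 * B * r + 4 * norm v * r"
  \<comment> \<open>With this \<open>k\<close>, Young's inequality gives \<open>C \<rho> \<le> k \<rho>\<^sup>2 + 2 l r\<^sup>2\<close>.\<close>
  define k where "k = C\<^sup>2 / (8 * l * r\<^sup>2)"
  define E0 where "E0 = \<delta> / r ^ 4"
  have "E0 > 0" using \<open>\<delta> > 0\<close> r by (simp add: E0_def)
  define \<phi> where "\<phi> y t = E0 * exp (- k * (t - t2)) * (r\<^sup>2 - y \<bullet> y)\<^sup>2" for y :: "real ^ 'n" and t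
  define G where "G = (\<lambda>(y, t). u (X t + y, t) + \<phi> y t)"
  define Tube :: "'n spacetime set" where "Tube = cball 0 r \<times> {t2..t1}"
  have in_dom: "(X t + y, t) \<in> \<Omega>" if "norm y \<le> r" "t2 \<le> t" "t \<le> t1" for y t
  proof -
    have "(X t + y, t) \<in> ball (X t, t) e"
      using that r by (simp add: dist_Pair_Pair dist_norm)
    then show ?thesis using e(2) X_seg[OF that(2,3)] by blast
  qed
  have "compact Tube" unfolding Tube_def by (intro compact_Times compact_cball compact_Icc)
  moreover have "continuous_on Tube G"
  proof -
    have "continuous_on Tube (\<lambda>w. u (X (snd w) + fst w, snd w))"
      by (rule continuous_on_compose2[OF continuous_u])
        (auto simp: X_def Tube_def intro!: continuous_intros in_dom[unfolded X_def])
    then show ?thesis unfolding G_def \<phi>_def split_beta by (intro continuous_intros)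
  qed
  moreover have "(0, t1) \<in> Tube" using t12 r by (simp add: Tube_def)
  ultimately obtain w where w: "w \<in> Tube" "\<And>w'. w' \<in> Tube \<Longrightarrow> G w' \<le> G w"
    using continuous_attains_sup[of Tube G] by blast
  obtain y t where yt: "w = (y, t)" by (metis prod.collapse)
  have y: "norm y \<le> r" and t: "t2 \<le> t" "t \<le> t1" using w(1) by (auto simp: Tube_def yt)
  let ?z = "(X t + y, t)"
  have G_max: "u (X t' + y', t') + \<phi> y' t' \<le> u ?z + \<phi> y t" if "norm y' \<le> r" "t2 \<le> t'" "t' \<le> t1" for y' t'
    using w(2)[of "(y', t')"] that by (simp add: Tube_def G_def yt)
  have zO: "?z \<in> \<Omega>" using in_dom y t by blast
  have "\<phi> 0 t1 > 0" using \<open>E0 > 0\<close> r by (simp add: \<phi>_def)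
  then have above: "u ?z + \<phi> y t > m"
    using G_max[of 0 t1] t12 r X1 top z by simp
  \<comment> \<open>The maximum is not on the lateral boundary, where the barrier vanishes.\<close>
  have "norm y \<noteq> r"
  proof
    assume "norm y = r"
    then have "\<phi> y t = 0" by (simp add: \<phi>_def dot_square_norm)
    then show False using above mx[OF zO] by simp
  qed
  with y have y_lt: "norm y < r" by simp
  \<comment> \<open>It is not on the bottom, where \<open>u < m - \<delta>\<close> and the barrier is at most \<open>\<delta>\<close>.\<close>
  have "t \<noteq> t2"
  proof
    assume tt: "t = t2"
    have "dist ?z z2 < d" using y r by (simp add: tt X2 z dist_Pair_Pair dist_norm)
    then have "\<bar>u ?z - u z2\<bar> < \<delta>" by (rule d(2))
    moreover have "m - \<delta> = u z2 + \<delta>" by (simp add: \<delta>_def field_simps)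
    ultimately have "u ?z < m - \<delta>" by linarith
    moreover have "\<phi> y t \<le> \<delta>"
    proof -
      have "(r\<^sup>2 - y \<bullet> y)\<^sup>2 \<le> (r\<^sup>2)\<^sup>2"
        using y r by (intro power_mono) (auto simp: dot_square_norm intro!: power_mono)
      then have "E0 * (r\<^sup>2 - y \<bullet> y)\<^sup>2 \<le> E0 * (r\<^sup>2)\<^sup>2" using \<open>E0 > 0\<close> by simp
      also have "\<dots> = \<delta>" using r by (simp add: E0_def)
      finally show ?thesis by (simp add: \<phi>_def tt)
    qed
    ultimately show False using above by simp
  qed
  with t have t2: "t2 < t" by simp
  define \<rho> where "\<rho> = r\<^sup>2 - y \<bullet> y"
  have "\<rho> > 0" using y_lt r by (simp add: \<rho>_def dot_square_norm power_strict_mono)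
  define E where "E = E0 * exp (- k * (t - t2))"
  have "E > 0" using \<open>E0 > 0\<close> by (simp add: E_def)
  have spatial: "(\<Sum>j\<in>UNIV. \<xi> $ j * p j ?z) = 4 * E * \<rho> * (y \<bullet> \<xi>)"
    "(\<Sum>j\<in>UNIV. \<xi> $ j * (\<Sum>i\<in>UNIV. \<xi> $ i * H i j ?z)) + E * (8 * (y \<bullet> \<xi>)\<^sup>2 - 4 * \<rho> * (\<xi> \<bullet> \<xi>)) \<le> 0" for \<xi>
  proof -
    define s W where "s = y \<bullet> \<xi>" and "W = \<xi> \<bullet> \<xi>"
    define \<psi> where "\<psi> h = E * (\<rho> - 2 * h * s - h\<^sup>2 * W)\<^sup>2" for h
    define \<psi>' where "\<psi>' h = E * (2 * (\<rho> - 2 * h * s - h\<^sup>2 * W) * (- 2 * s - 2 * h * W))" for h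
    have 1: "(\<psi> has_field_derivative \<psi>' h) (at h)" for h
      unfolding \<psi>_def \<psi>'_def by (auto intro!: derivative_eq_intros)
    have 2: "(\<psi>' has_field_derivative E * (8 * s\<^sup>2 - 4 * \<rho> * W)) (at 0)"
      unfolding \<psi>'_def by (auto intro!: derivative_eq_intros simp: power2_eq_square algebra_simps)
    have "((\<lambda>h::real. norm (y + h *\<^sub>R \<xi>)) \<longlongrightarrow> norm (y + 0 *\<^sub>R \<xi>)) (nhds 0)"
      by (intro tendsto_intros filterlim_ident)
    then have "\<forall>\<^sub>F h in nhds (0::real). norm (y + h *\<^sub>R \<xi>) < r"
      using y_lt by (intro order_tendstoD) auto
    then have 3: "\<forall>\<^sub>F h in nhds 0. u (?z + h *\<^sub>R (\<xi>, 0)) + \<psi> h \<le> u ?z + \<psi> 0"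
    proof eventually_elim
      case (elim h)
      have "\<phi> (y + h *\<^sub>R \<xi>) t = \<psi> h"
        by (simp add: \<phi>_def \<psi>_def E_def \<rho>_def s_def W_def inner_add_left inner_add_right inner_commute
            power2_eq_square algebra_simps)
      moreover have "\<phi> y t = \<psi> 0" by (simp add: \<phi>_def \<psi>_def E_def \<rho>_def)
      ultimately show ?case using G_max[of "y + h *\<^sub>R \<xi>" t] elim t by (simp add: add.assoc)
    qed
    show "(\<Sum>j\<in>UNIV. \<xi> $ j * p j ?z) = 4 * E * \<rho> * (y \<bullet> \<xi>)"
      using spatial_max_test(1)[OF zO 1 2 3] by (simp add: \<psi>'_def s_def)
    show "(\<Sum>j\<in>UNIV. \<xi> $ j * (\<Sum>i\<in>UNIV. \<xi> $ i * H i j ?z)) + E * (8 * (y \<bullet> \<xi>)\<^sup>2 - 4 * \<rho> * (\<xi> \<bullet> \<xi>)) \<le> 0"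
      using spatial_max_test(2)[OF zO 1 2 3] by (simp add: s_def W_def)
  qed
  have grad: "p j ?z = 4 * E * \<rho> * y $ j" for j
    using spatial(1)[of "axis j 1"]
    by (simp add: sum_axis_mult inner_axis)
  \<comment> \<open>Only a one-sided inequality: \<open>t\<close> may be the top time, so the point is compared with earlier ones at the same position \<open>x\<close>, whose coordinate is \<open>y + h v\<close> at time \<open>t - h\<close>.\<close>
  have q: "q ?z + E * (4 * \<rho> * (y \<bullet> v) - k * \<rho>\<^sup>2) \<ge> 0"
  proof (rule ccontr)
    assume neg: "\<not> ?thesis"
    define \<psi> where "\<psi> h = E * exp (- k * h) * (\<rho> + 2 * h * (y \<bullet> v) - h\<^sup>2 * (v \<bullet> v))\<^sup>2" for h
    have "(\<psi> has_field_derivative E * (4 * \<rho> * (y \<bullet> v) - k * \<rho>\<^sup>2)) (at 0)"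
      unfolding \<psi>_def by (auto intro!: derivative_eq_intros simp: power2_eq_square algebra_simps)
    note der = DERIV_add[OF derivative_t[OF zO] this]
    have "q ?z + E * (4 * \<rho> * (y \<bullet> v) - k * \<rho>\<^sup>2) < 0" using neg by simp
    from DERIV_neg_dec_left[OF der this]
    obtain d1 where d1: "d1 > 0" "\<forall>h>0. h < d1 \<longrightarrow>
        u ?z + \<psi> 0 < u (?z + (- h) *\<^sub>R (0, 1)) + \<psi> (- h)"
      by auto
    have "((\<lambda>h::real. norm (y + h *\<^sub>R v)) \<longlongrightarrow> norm (y + 0 *\<^sub>R v)) (nhds 0)"
      by (intro tendsto_intros filterlim_ident)
    then have "\<forall>\<^sub>F h in nhds (0::real). norm (y + h *\<^sub>R v) < r"
      using y_lt by (intro order_tendstoD) auto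
    then obtain d2 where d2: "d2 > 0" "\<And>h. \<bar>h\<bar> < d2 \<Longrightarrow> norm (y + h *\<^sub>R v) < r"
      unfolding eventually_nhds_metric dist_real_def by auto
    define h where "h = Min {d1, d2, t - t2} / 2"
    have h: "0 < h" "h < d1" "h < d2" "h < t - t2" using d1(1) d2(1) t2 by (auto simp: h_def)
    have \<phi>_h: "\<phi> (y + h *\<^sub>R v) (t - h) = \<psi> (- h)"
    proof -
      have "E0 * exp (- k * (t - h - t2)) = E * exp (- k * - h)"
        by (simp add: E_def algebra_simps flip: exp_add)
      moreover have "r\<^sup>2 - (y + h *\<^sub>R v) \<bullet> (y + h *\<^sub>R v) = \<rho> + 2 * (- h) * (y \<bullet> v) - (- h)\<^sup>2 * (v \<bullet> v)"
        by (simp add: \<rho>_def inner_add_left inner_add_right inner_commute power2_eq_square algebra_simps)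
      ultimately show ?thesis unfolding \<phi>_def \<psi>_def by simp
    qed
    moreover have "\<phi> y t = \<psi> 0" by (simp add: \<phi>_def \<psi>_def E_def \<rho>_def)
    moreover have X_h: "X (t - h) + (y + h *\<^sub>R v) = X t + y"
      by (simp add: X_def algebra_simps)
    have "u (X t + y, t - h) + \<psi> (- h) \<le> u ?z + \<phi> y t"
      using G_max[of "y + h *\<^sub>R v" "t - h"] d2(2)[of h] h t unfolding X_h \<phi>_h by simp
    ultimately show False
      using d1(2)[rule_format, of h] h by simp
  qed
  \<comment> \<open>\<open>Hm\<close> is the matrix of second spatial derivatives of \<open>u + \<phi>\<close> at the contact point.\<close>
  define Hm :: "real ^ 'n ^ 'n" where
    "Hm = (\<chi> i j. H i j ?z + 8 * E * (y $ i * y $ j) - (if i = j then 4 * E * \<rho> else 0))"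
  have "(Hm *v \<xi>) \<bullet> \<xi> \<le> 0" for \<xi>
  proof -
    have "(Hm *v \<xi>) \<bullet> \<xi> = (\<Sum>i\<in>UNIV. \<Sum>j\<in>UNIV. \<xi> $ i * \<xi> $ j * H i j ?z)
        + 8 * E * (y \<bullet> \<xi>)\<^sup>2 - 4 * E * \<rho> * (\<xi> \<bullet> \<xi>)"
    proof -
      have "(Hm *v \<xi>) \<bullet> \<xi> = (\<Sum>i\<in>UNIV. \<Sum>j\<in>UNIV. \<xi> $ i * \<xi> $ j * H i j ?z
          + 8 * E * ((y $ i * \<xi> $ i) * (y $ j * \<xi> $ j)) - (if i = j then 4 * E * \<rho> * (\<xi> $ i * \<xi> $ j) else 0))"
        unfolding Hm_def matrix_vector_mult_def inner_vec_def
        by (simp add: sum_distrib_right) (intro sum.cong refl, auto simp: algebra_simps)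
      also have "\<dots> = (\<Sum>i\<in>UNIV. \<Sum>j\<in>UNIV. \<xi> $ i * \<xi> $ j * H i j ?z)
          + 8 * E * (\<Sum>i\<in>UNIV. \<Sum>j\<in>UNIV. (y $ i * \<xi> $ i) * (y $ j * \<xi> $ j))
          - 4 * E * \<rho> * (\<Sum>i\<in>UNIV. \<xi> $ i * \<xi> $ i)"
        by (simp add: sum.distrib sum_subtractf sum_distrib_left)
      also have "(\<Sum>i\<in>UNIV. \<Sum>j\<in>UNIV. (y $ i * \<xi> $ i) * (y $ j * \<xi> $ j)) = (y \<bullet> \<xi>)\<^sup>2"
        by (simp add: inner_vec_def power2_eq_square sum_product)
      finally show ?thesis by (simp add: inner_vec_def)
    qed
    moreover have "(\<Sum>i\<in>UNIV. \<Sum>j\<in>UNIV. \<xi> $ i * \<xi> $ j * H i j ?z)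
        = (\<Sum>j\<in>UNIV. \<xi> $ j * (\<Sum>i\<in>UNIV. \<xi> $ i * H i j ?z))"
      by (subst sum.swap) (simp add: sum_distrib_left mult_ac)
    ultimately show ?thesis using spatial(2)[of \<xi>] by (simp add: algebra_simps)
  qed
  then have "(\<Sum>i\<in>UNIV. \<Sum>j\<in>UNIV. a ?z $ i $ j * Hm $ i $ j) \<le> 0"
    by (intro trace_mult_nonpos symmetric psd)
  moreover have "(\<Sum>i\<in>UNIV. \<Sum>j\<in>UNIV. a ?z $ i $ j * Hm $ i $ j)
      = (\<Sum>i\<in>UNIV. \<Sum>j\<in>UNIV. a ?z $ i $ j * H i j ?z) + 8 * E * ((a ?z *v y) \<bullet> y)
        - 4 * E * \<rho> * (\<Sum>i\<in>UNIV. a ?z $ i $ i)"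
  proof -
    have "(\<Sum>i\<in>UNIV. \<Sum>j\<in>UNIV. a ?z $ i $ j * Hm $ i $ j)
      = (\<Sum>i\<in>UNIV. \<Sum>j\<in>UNIV. a ?z $ i $ j * H i j ?z + 8 * E * (a ?z $ i $ j * y $ j * y $ i)
          - (if i = j then 4 * E * \<rho> * a ?z $ i $ j else 0))"
      unfolding Hm_def by (intro sum.cong refl) (auto simp: algebra_simps)
    also have "\<dots> = (\<Sum>i\<in>UNIV. \<Sum>j\<in>UNIV. a ?z $ i $ j * H i j ?z)
        + 8 * E * (\<Sum>i\<in>UNIV. \<Sum>j\<in>UNIV. a ?z $ i $ j * y $ j * y $ i)
        - 4 * E * \<rho> * (\<Sum>i\<in>UNIV. a ?z $ i $ i)"
      by (simp add: sum.distrib sum_subtractf sum_distrib_left)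
    also have "(\<Sum>i\<in>UNIV. \<Sum>j\<in>UNIV. a ?z $ i $ j * y $ j * y $ i) = (a ?z *v y) \<bullet> y"
      by (simp add: matrix_vector_mult_def inner_vec_def sum_distrib_right)
    finally show ?thesis .
  qed
  ultimately have second_order: "(\<Sum>i\<in>UNIV. \<Sum>j\<in>UNIV. a ?z $ i $ j * H i j ?z)
      \<le> E * (4 * \<rho> * (\<Sum>i\<in>UNIV. a ?z $ i $ i) - 8 * ((a ?z *v y) \<bullet> y))"
    by (simp add: algebra_simps)
  have "(\<Sum>j\<in>UNIV. \<beta> ?z $ j * p j ?z) = E * (4 * \<rho> * (\<beta> ?z \<bullet> y))"
    by (simp add: grad inner_vec_def sum_distrib_left mult_ac)
  with second_order q equation[OF zO] f[OF zO]
  have "0 \<le> E * (4 * \<rho> * (\<Sum>i\<in>UNIV. a ?z $ i $ i) - 8 * ((a ?z *v y) \<bullet> y)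
      + 4 * \<rho> * (\<beta> ?z \<bullet> y) + 4 * \<rho> * (y \<bullet> v) - k * \<rho>\<^sup>2)"
    by (simp add: algebra_simps)
  with \<open>E > 0\<close> have nonneg: "0 \<le> 4 * \<rho> * (\<Sum>i\<in>UNIV. a ?z $ i $ i) - 8 * ((a ?z *v y) \<bullet> y)
      + 4 * \<rho> * (\<beta> ?z \<bullet> y) + 4 * \<rho> * (y \<bullet> v) - k * \<rho>\<^sup>2"
    by (simp add: zero_le_mult_iff)
  have "l * (r\<^sup>2 - \<rho>) \<le> (a ?z *v y) \<bullet> y"
    using lower[of y ?z] by (simp add: \<rho>_def dot_square_norm)
  moreover have "\<rho> * (\<Sum>i\<in>UNIV. a ?z $ i $ i) \<le> \<rho> * (n * L)"
  proof (rule mult_left_mono)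
    have "a ?z $ i $ i \<le> L" for i
      using upper[where \<xi> = "axis i 1" and z = ?z] by (simp add: matrix_vector_mul_component inner_axis)
    then show "(\<Sum>i\<in>UNIV. a ?z $ i $ i) \<le> n * L"
      using sum_bounded_above[of UNIV "\<lambda>i. a ?z $ i $ i" L] by (simp add: n_def)
  qed (use \<open>\<rho> > 0\<close> in simp)
  moreover have "\<rho> * (\<beta> ?z \<bullet> y) \<le> \<rho> * (B * r)"
  proof (rule mult_left_mono)
    have "\<beta> ?z \<bullet> y \<le> norm (\<beta> ?z) * norm y" by (rule norm_cauchy_schwarz)
    also have "\<dots> \<le> B * r" using drift[of ?z] y order_trans[OF norm_ge_zero drift[of ?z]] by (intro mult_mono) auto
    finally show "\<beta> ?z \<bullet> y \<le> B * r" .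
  qed (use \<open>\<rho> > 0\<close> in simp)
  moreover have "\<rho> * (y \<bullet> v) \<le> \<rho> * (norm v * r)"
  proof (rule mult_left_mono)
    have "y \<bullet> v \<le> norm y * norm v" by (rule norm_cauchy_schwarz)
    also have "\<dots> \<le> r * norm v" using y by (intro mult_right_mono) auto
    finally show "y \<bullet> v \<le> norm v * r" by (simp add: mult.commute)
  qed (use \<open>\<rho> > 0\<close> in simp)
  ultimately have "0 \<le> C * \<rho> - 8 * l * r\<^sup>2 - k * \<rho>\<^sup>2"
    using nonneg by (simp add: C_def algebra_simps)
  moreover have "C * \<rho> \<le> k * \<rho>\<^sup>2 + 2 * l * r\<^sup>2"
  proof -
    define Q where "Q = 8 * l * r\<^sup>2"
    have "Q > 0" using l_pos r by (simp add: Q_def)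
    then have "0 \<le> (C * \<rho> - Q / 2)\<^sup>2 / Q" by simp
    also have "\<dots> = C\<^sup>2 / Q * \<rho>\<^sup>2 + Q / 4 - C * \<rho>"
      using \<open>Q > 0\<close> by (simp add: field_simps power2_eq_square)
    also have "\<dots> = k * \<rho>\<^sup>2 + 2 * l * r\<^sup>2 - C * \<rho>" by (simp add: k_def Q_def)
    finally show ?thesis by simp
  qed
  moreover have "l * r\<^sup>2 > 0" using l_pos r by simp
  ultimately show False by (simp add: algebra_simps)
qed

end

section \<open>Propagation of maxima along admissible curves\<close>

text \<open>The derivative of the time component is prescribed only almost everywhere; absolute continuity
  is what makes it determine the time component.\<close>

lemma admissible_curve_time:
  assumes "admissible_curve T \<gamma>" and s: "0 \<le> s" "s \<le> T"
  shows "snd (\<gamma> s) = snd (\<gamma> 0) - s"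
proof -
  obtain v where ac: "abs_continuous_on 0 T \<gamma>"
    and v: "AE s in lebesgue. s \<in> {0..T} \<longrightarrow> (\<gamma> has_vector_derivative (v s, -1)) (at s within {0..T})"
    using assms(1) unfolding admissible_curve_def by blast
  obtain N where N: "negligible N" and
    der: "\<And>x. x \<in> {0..T} \<Longrightarrow> x \<notin> N \<Longrightarrow> (\<gamma> has_vector_derivative (v x, -1)) (at x within {0..T})"
    using v unfolding eventually_ae_filter_negligible by blast
  let ?h = "\<lambda>x. snd (\<gamma> x) + x"
  have "?h s = ?h 0"
  proof (rule abs_continuous_on_zero_derivative_AE_imp_const[OF _ s(1) N])
    show "abs_continuous_on 0 s ?h"
      by (intro abs_continuous_on_subinterval[OF abs_continuous_on_add_id[OF abs_continuous_on_snd[OF ac]]])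
        (use s in auto)
    fix x assume x: "x \<in> {0..s} - N"
    then have "(\<gamma> has_vector_derivative (v x, -1)) (at x within {0..s})"
      using der[of x] s by (auto intro: has_vector_derivative_within_subset)
    then have "((\<lambda>x. snd (\<gamma> x)) has_vector_derivative snd (v x, -1 :: real)) (at x within {0..s})"
      by (rule bounded_linear.has_vector_derivative[OF bounded_linear_snd])
    then have "(?h has_vector_derivative snd (v x, -1 :: real) + 1) (at x within {0..s})"
      by (intro has_vector_derivative_add has_vector_derivative_id)
    then show "(?h has_vector_derivative 0) (at x within {0..s})" by simp
  qed
  then show ?thesis by simp
qed

context nondivergence_solution
begin

text \<open>The curve is replaced by an inscribed polygon whose sides stay within a distance \<open>e\<close> of it, hence
  in \<open>\<Omega>\<close>. Time decreases strictly along each side, so the maximum passes from vertex to vertex.\<close>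

lemma max_propagates_to_attainable_set:
  assumes mx: "\<And>w. w \<in> \<Omega> \<Longrightarrow> u w \<le> u z0" and f: "\<And>w. w \<in> \<Omega> \<Longrightarrow> 0 \<le> f w"
    and z: "z \<in> attainable_set z0 \<Omega>"
  shows "u z = u z0"
proof -
  obtain T \<gamma> where T: "0 \<le> T" and adm: "admissible_curve T \<gamma>" and im: "\<gamma> ` {0..T} \<subseteq> \<Omega>"
    and ends: "\<gamma> 0 = z0" "\<gamma> T = z"
    using z unfolding attainable_set_def by blast
  have cont: "continuous_on {0..T} \<gamma>"
    using adm unfolding admissible_curve_def by (auto intro: abs_continuous_on_imp_continuous_on)
  obtain e where e: "e > 0" "(\<Union>w\<in>\<gamma> ` {0..T}. ball w e) \<subseteq> \<Omega>"
    using compact_subset_open_imp_ball_epsilon_subset[OF compact_continuous_image[OF cont compact_Icc] open_domain im] .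
  obtain \<delta> where \<delta>: "\<delta> > 0"
    "\<And>s s'. s \<in> {0..T} \<Longrightarrow> s' \<in> {0..T} \<Longrightarrow> dist s' s < \<delta> \<Longrightarrow> dist (\<gamma> s') (\<gamma> s) < e"
    using compact_uniformly_continuous[OF cont compact_Icc] \<open>e > 0\<close>
    unfolding uniformly_continuous_on_def by metis
  obtain n :: nat where n: "T / \<delta> < real n" using reals_Archimedean2 by blast
  have "0 \<le> T / \<delta>" using T \<delta>(1) by simp
  with n have n0: "0 < real n" by linarith
  define \<tau> where "\<tau> = T / real n"
  have \<tau>: "0 \<le> \<tau>" "\<tau> < \<delta>" "real n * \<tau> = T"
    using n n0 T \<delta>(1) by (auto simp: \<tau>_def field_simps)
  have "k \<le> n \<Longrightarrow> u (\<gamma> (real k * \<tau>)) = u z0" for k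
  proof (induction k)
    case 0
    then show ?case by (simp add: ends)
  next
    case (Suc k)
    let ?s = "real k * \<tau>" and ?s' = "real (Suc k) * \<tau>"
    have "real (Suc k) * \<tau> \<le> real n * \<tau>" using Suc.prems \<tau>(1) by (intro mult_right_mono) auto
    then have s': "?s' \<in> {0..T}" using \<tau> by auto
    have s: "?s \<in> {0..T}" using s' \<tau>(1) by (auto simp: algebra_simps)
    show ?case
    proof (cases "\<tau> = 0")
      case True
      then show ?thesis by (simp add: ends)
    next
      case False
      show ?thesis
      proof (rule max_propagates_along_segment[OF mx f])
        have "dist (\<gamma> ?s') (\<gamma> ?s) < e"
          using \<tau> by (intro \<delta>(2) s s') (simp add: dist_real_def algebra_simps)
        then have "closed_segment (\<gamma> ?s) (\<gamma> ?s') \<subseteq> ball (\<gamma> ?s) e"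
          using \<open>e > 0\<close> by (intro closed_segment_subset convex_ball) (auto simp: dist_commute)
        then show "closed_segment (\<gamma> ?s) (\<gamma> ?s') \<subseteq> \<Omega>" using e(2) s by blast
        have "snd (\<gamma> ?s) = snd (\<gamma> 0) - ?s" "snd (\<gamma> ?s') = snd (\<gamma> 0) - ?s'"
          by (rule admissible_curve_time[OF adm]; use s s' in simp)+
        then show "snd (\<gamma> ?s') < snd (\<gamma> ?s)"
          using False \<tau>(1) by (simp add: algebra_simps)
        show "u (\<gamma> ?s) = u z0" using Suc by simp
      qed
    qed
  qed
  from this[of n] show ?thesis by (simp add: \<tau>(3) ends)
qed

lemma strong_maximum_principle:
  assumes "continuous_on \<Omega> f"
    and mx: "\<And>w. w \<in> \<Omega> \<Longrightarrow> u w \<le> u z0" and f: "\<And>w. w \<in> \<Omega> \<Longrightarrow> 0 \<le> f w"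
    and z: "z \<in> top_of_set \<Omega> closure_of attainable_set z0 \<Omega>"
  shows "u z = u z0 \<and> f z = 0"
proof -
  let ?S = "{w \<in> \<Omega>. u w = u z0} \<inter> {w \<in> \<Omega>. f w = 0}"
  have "closedin (top_of_set \<Omega>) ?S"
    by (intro closedin_Int continuous_closedin_preimage_constant continuous_u assms(1))
  moreover have "attainable_set z0 \<Omega> \<subseteq> ?S"
  proof
    fix w assume w: "w \<in> attainable_set z0 \<Omega>"
    then have "w \<in> \<Omega>" by (simp add: attainable_set_def)
    moreover have "u w = u z0" using max_propagates_to_attainable_set[OF mx f w] .
    moreover have "f w = 0"
      using \<open>w \<in> \<Omega>\<close> mx f \<open>u w = u z0\<close> by (intro source_zero_at_max) auto
    ultimately show "w \<in> ?S" by simp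
  qed
  ultimately have "top_of_set \<Omega> closure_of attainable_set z0 \<Omega> \<subseteq> ?S" by (intro closure_of_minimal)
  from subsetD[OF this z] show ?thesis by simp
qed

lemma nondivergence_solution_minus:
  "nondivergence_solution \<Omega> a \<beta> l L B (\<lambda>z. - u z) (\<lambda>z. - f z) (\<lambda>z. - q z) (\<lambda>j z. - p j z) (\<lambda>i j z. - H i j z)"
proof
  show "(\<Sum>i\<in>UNIV. \<Sum>j\<in>UNIV. a z $ i $ j * - H i j z) + (\<Sum>j\<in>UNIV. \<beta> z $ j * - p j z) - - q z = - f z"
    if "z \<in> \<Omega>" for z
    using equation[OF that] by (simp add: sum_negf)
  show "continuous_on \<Omega> (\<lambda>z. - u z)" "continuous_on \<Omega> (\<lambda>z. - p j z)" "continuous_on \<Omega> (\<lambda>z. - H i j z)" for i j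
    by (rule continuous_on_minus, rule continuous_u continuous_p continuous_H)+
  show "((\<lambda>h. - u (z + h *\<^sub>R (axis j 1, 0))) has_field_derivative - p j z) (at 0)"
    "((\<lambda>h. - p j (z + h *\<^sub>R (axis i 1, 0))) has_field_derivative - H i j z) (at 0)"
    "((\<lambda>h. - u (z + h *\<^sub>R (0, 1))) has_field_derivative - q z) (at 0)" if "z \<in> \<Omega>" for z i j
    by (rule DERIV_minus, rule derivative_u derivative_p derivative_t, rule that)+
qed (fact open_domain symmetric l_pos lower upper drift)+

end

section \<open>Equations in divergence form\<close>

lemma dir_deriv_has_field_derivative:
  assumes "dir_differentiable e g z"
  shows "((\<lambda>h. g (z + h *\<^sub>R e)) has_field_derivative dir_deriv e g z) (at 0)"
  using assms unfolding dir_differentiable_def dir_deriv_def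
  by (simp add: DERIV_deriv_iff_real_differentiable)

lemma dir_deriv_sum_mult:
  assumes "\<And>j. j \<in> S \<Longrightarrow> dir_differentiable e (F j) z" "\<And>j. j \<in> S \<Longrightarrow> dir_differentiable e (G j) z"
  shows "dir_deriv e (\<lambda>w. \<Sum>j\<in>S. F j w * G j w) z
    = (\<Sum>j\<in>S. dir_deriv e (F j) z * G j z + F j z * dir_deriv e (G j) z)"
proof -
  have "((\<lambda>h. \<Sum>j\<in>S. F j (z + h *\<^sub>R e) * G j (z + h *\<^sub>R e)) has_field_derivative
      (\<Sum>j\<in>S. dir_deriv e (F j) z * G j (z + 0 *\<^sub>R e) + dir_deriv e (G j) z * F j (z + 0 *\<^sub>R e))) (at 0)"
    using assms by (intro DERIV_sum DERIV_mult dir_deriv_has_field_derivative)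
  then show ?thesis
    unfolding dir_deriv_def[of e "\<lambda>w. \<Sum>j\<in>S. F j w * G j w"]
    by (subst DERIV_imp_deriv) (auto simp: mult.commute)
qed

text \<open>Expanding the divergence moves the derivatives of the coefficients into the drift. The product
  rule is applied along coordinate lines, so one-dimensional differentiability of the factors is enough.\<close>

lemma parabolic_op_nondivergence:
  assumes A: "\<And>i j. dx_exists i (\<lambda>w. A w $ i $ j) z" and u: "\<And>i j. dx_exists i (dx j u) z"
  shows "parabolic_op A b c u z = (\<Sum>i\<in>UNIV. \<Sum>j\<in>UNIV. A z $ i $ j * dx i (dx j u) z)
    + (\<Sum>j\<in>UNIV. (b z + (\<chi> j. \<Sum>i\<in>UNIV. dx i (\<lambda>w. A w $ i $ j) z)) $ j * dx j u z) + c z * u z - dt u z"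
proof -
  have "div_x (\<lambda>w. A w *v grad_x u w) z
      = (\<Sum>i\<in>UNIV. \<Sum>j\<in>UNIV. dx i (\<lambda>w. A w $ i $ j) z * dx j u z + A z $ i $ j * dx i (dx j u) z)"
    unfolding div_x_def grad_x_def matrix_vector_mult_def vec_lambda_beta
    by (intro sum.cong refl dir_deriv_sum_mult A u)
  also have "\<dots> = (\<Sum>j\<in>UNIV. (\<Sum>i\<in>UNIV. dx i (\<lambda>w. A w $ i $ j) z) * dx j u z)
      + (\<Sum>i\<in>UNIV. \<Sum>j\<in>UNIV. A z $ i $ j * dx i (dx j u) z)"
    by (simp add: sum.distrib sum_distrib_right) (rule sum.swap)
  finally show ?thesis
    by (simp add: parabolic_op_def grad_x_def inner_vec_def distrib_right sum.distrib)
qed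

lemma classical_solution_nondivergence:
  fixes A :: "'n::finite spacetime \<Rightarrow> real ^ 'n ^ 'n"
  assumes std: "standing_assumptions A b c M \<alpha> l L" and c: "\<And>z. c z = 0" and \<Omega>: "open \<Omega>"
    and sol: "classical_solution A b c f \<Omega> u"
  shows "nondivergence_solution \<Omega> A (\<lambda>z. b z + (\<chi> j. \<Sum>i\<in>UNIV. dx i (\<lambda>w. A w $ i $ j) z))
    l L (real CARD('n) * (L + real CARD('n) * L)) u f (dt u) (\<lambda>j. dx j u) (\<lambda>i j. dx i (dx j u))"
    (is "nondivergence_solution \<Omega> A ?\<beta> l L ?B u f ?q ?p ?H")
proof
  show "open \<Omega>" by fact
  show "transpose (A z) = A z" "0 < l" "l * (norm \<xi>)\<^sup>2 \<le> (A z *v \<xi>) \<bullet> \<xi>"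
    "(A z *v \<xi>) \<bullet> \<xi> \<le> L * (norm \<xi>)\<^sup>2" for z \<xi>
    using std unfolding standing_assumptions_def by blast+
  have bL: "\<bar>b z $ j\<bar> \<le> L" and AL: "\<bar>dx i (\<lambda>w. A w $ i $ j) z\<bar> \<le> L"
    and dA: "dx_exists i (\<lambda>w. A w $ i $ j) z" for i j z
    using std unfolding standing_assumptions_def by blast+
  show "norm (?\<beta> z) \<le> ?B" for z
  proof -
    have "\<bar>?\<beta> z $ j\<bar> \<le> L + real CARD('n) * L" for j
    proof -
      have "\<bar>\<Sum>i\<in>UNIV. dx i (\<lambda>w. A w $ i $ j) z\<bar> \<le> (\<Sum>i\<in>UNIV. \<bar>dx i (\<lambda>w. A w $ i $ j) z\<bar>)"
        by (rule sum_abs)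
      also have "\<dots> \<le> real CARD('n) * L"
        using sum_bounded_above[of UNIV "\<lambda>i. \<bar>dx i (\<lambda>w. A w $ i $ j) z\<bar>" L] AL by simp
      finally show ?thesis using bL[of z j] by simp
    qed
    then have "(\<Sum>j\<in>UNIV. \<bar>?\<beta> z $ j\<bar>) \<le> ?B"
      using sum_bounded_above[of UNIV "\<lambda>j. \<bar>?\<beta> z $ j\<bar>" "L + real CARD('n) * L"] by simp
    then show ?thesis using norm_le_l1_cart[of "?\<beta> z"] by linarith
  qed
  show "continuous_on \<Omega> u" "continuous_on \<Omega> (?p j)" "continuous_on \<Omega> (?H i j)" for i j
    using sol unfolding classical_solution_def by blast+
  have ex: "dt_exists u z" "dx_exists j u z" "dx_exists i (dx j u) z" if "z \<in> \<Omega>" for z i j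
    using sol that unfolding classical_solution_def by blast+
  show "((\<lambda>h. u (z + h *\<^sub>R (axis j 1, 0))) has_field_derivative ?p j z) (at 0)"
    "((\<lambda>h. ?p j (z + h *\<^sub>R (axis i 1, 0))) has_field_derivative ?H i j z) (at 0)"
    "((\<lambda>h. u (z + h *\<^sub>R (0, 1))) has_field_derivative ?q z) (at 0)" if "z \<in> \<Omega>" for z i j
    by (rule dir_deriv_has_field_derivative, rule ex, rule that)+
  show "(\<Sum>i\<in>UNIV. \<Sum>j\<in>UNIV. A z $ i $ j * ?H i j z) + (\<Sum>j\<in>UNIV. ?\<beta> z $ j * ?p j z) - ?q z = f z"
    if "z \<in> \<Omega>" for z
  proof -
    have "parabolic_op A b c u z = f z" using sol that unfolding classical_solution_def by blast
    then show ?thesis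
      using parabolic_op_nondivergence[OF dA ex(3)[OF that], of b c] c by simp
  qed
qed

theorem proposition1p3:
  fixes A :: "'n::finite spacetime \<Rightarrow> real ^ 'n ^ 'n"
    and b :: "'n spacetime \<Rightarrow> real ^ 'n"
    and c f u :: "'n spacetime \<Rightarrow> real"
    and M \<alpha> l L :: real
    and \<Omega> :: "'n spacetime set"
    and z0 :: "'n spacetime"
  assumes "standing_assumptions A b c M \<alpha> l L"
    and "\<And>z. c z = 0"
    and "open \<Omega>"
    and "z0 \<in> \<Omega>"
    and "continuous_on \<Omega> f"
    and "classical_solution A b c f \<Omega> u"
  shows "((\<forall>z\<in>\<Omega>. u z \<le> u z0) \<and> (\<forall>z\<in>\<Omega>. f z \<ge> 0) \<longrightarrow>
           (\<forall>z \<in> top_of_set \<Omega> closure_of attainable_set z0 \<Omega>. u z = u z0 \<and> f z = 0)) \<and>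
         ((\<forall>z\<in>\<Omega>. u z0 \<le> u z) \<and> (\<forall>z\<in>\<Omega>. f z \<le> 0) \<longrightarrow>
           (\<forall>z \<in> top_of_set \<Omega> closure_of attainable_set z0 \<Omega>. u z = u z0 \<and> f z = 0))"
proof (intro conjI impI ballI; elim conjE)
  note nondiv = classical_solution_nondivergence[OF assms(1-3,6)]
  fix z assume z: "z \<in> top_of_set \<Omega> closure_of attainable_set z0 \<Omega>"
  {
    assume "\<forall>z\<in>\<Omega>. u z \<le> u z0" "\<forall>z\<in>\<Omega>. f z \<ge> 0"
    then show "u z = u z0" "f z = 0"
      using nondivergence_solution.strong_maximum_principle[OF nondiv assms(5) _ _ z] by blast+
  next
    assume "\<forall>z\<in>\<Omega>. u z0 \<le> u z" "\<forall>z\<in>\<Omega>. f z \<le> 0"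
    then have "- u z = - u z0 \<and> - f z = 0"
      by (intro nondivergence_solution.strong_maximum_principle[OF
            nondivergence_solution.nondivergence_solution_minus[OF nondiv] _ _ _ z]
          continuous_on_minus assms(5)) auto
    then show "u z = u z0" "f z = 0" by auto
  }
qed

end
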